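(* Let $\rho>0$, $\beta>0$ and $\alpha>0$, and set $T=1/\beta$. For $a>0$ and $c>0$ let $p_{a,c}$ be the thermodynamical pressure at inverse temperature $\beta$ and fugacity $\rho$ of the one-dimensional lattice gas with $n$ sites and two-body interaction $\varepsilon_{ij}=-\frac{c}{an}\exp\left(-\frac an|i-j|\right)$ (see context). Choose $c=c(a)=\alpha a^2$. Then, as $a\to\infty$: (1) the constants $\lambda_0(a)$ and $k(a)$ defined in the context satisfy $\lim_{a\to\infty}c(a)\lambda_0(a)=\lim_{a\to\infty}c(a)k(a)=\alpha$; (2) the pressure converges to that of the van der Waals lattice gas: $$\lim_{a\to\infty}p_{a,c(a)}=-T\log(1-d)-\alpha d^2,$$ where the density $d\in(0,1)$ is a maximizer over $x\in[0,1]$ of $x\log\rho+\alpha\beta x^2-x\log x-(1-x)\log(1-x)$, and satisfies $$\rho=e^{-2\alpha\beta d}\,\frac{d}{1-d}.$$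
   Context: Lattice gas: at most one particle per site on the $n$ sites $\{0,1,\dots,n-1\}$; the grand partition function at inverse temperature $\beta$ and fugacity $\rho$ is $$\mathcal{Z}_n=\sum_{S\subseteq\{0,\dots,n-1\}}\rho^{|S|}\exp\Big(-\beta\sum_{i<j,\ i,j\in S}\varepsilon_{ij}\Big),$$ and the pressure is $p_{a,c}=T\lim_{n\to\infty}\frac1n\log\mathcal{Z}_n$ (limit at fixed $\rho,\beta,a,c$; it exists). Thus the limit $n\to\infty$ is taken first, and then $a\to\infty$. $k(a)=\frac1{a^3}(a+e^{-a}-1)$, and $\lambda_0(a)=\frac{1}{a^2(1+y_0^2)}$ where $y_0$ is the smallest positive root of $y\tan(\frac12ay)=1$; $\lambda_0(a)$ is the largest eigenvalue of the integral operator on $L^2[0,1]$ with kernel $\frac1{2a}e^{-a|y-z|}$, and $k(a)$ is the integral of this kernel over $[0,1]^2$. Convention $0\log0=0$. *)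

theory Defs
  imports "HOL-Analysis.Analysis"
begin

text \<open>
  Lattice gas on the sites \<open>{0,\<dots>,n-1}\<close> with at most one particle per site: a configuration is
  the set \<open>S\<close> of occupied sites, and \<open>\<epsilon>\<close> is a two-body interaction.
\<close>

definition configuration_energy :: "(nat \<Rightarrow> nat \<Rightarrow> real) \<Rightarrow> nat set \<Rightarrow> real" where
  "configuration_energy \<epsilon> S = (\<Sum>(i, j) \<in> {(i, j) \<in> S \<times> S. i < j}. \<epsilon> i j)"

definition grand_partition :: "real \<Rightarrow> real \<Rightarrow> (nat \<Rightarrow> nat \<Rightarrow> real) \<Rightarrow> nat \<Rightarrow> real" where
  "grand_partition \<beta> \<rho> \<epsilon> n =
     (\<Sum>S \<in> Pow {0..<n}. \<rho> ^ card S * exp (- \<beta> * configuration_energy \<epsilon> S))"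

text \<open>The interaction depends on the number \<open>n\<close> of sites, its range being of order \<open>n / a\<close>.\<close>

definition exp_interaction :: "real \<Rightarrow> real \<Rightarrow> nat \<Rightarrow> nat \<Rightarrow> nat \<Rightarrow> real" where
  "exp_interaction a c n i j =
     - (c / (a * real n)) * exp (- (a / real n) * \<bar>real i - real j\<bar>)"

definition pressure_seq :: "real \<Rightarrow> real \<Rightarrow> real \<Rightarrow> real \<Rightarrow> nat \<Rightarrow> real" where
  "pressure_seq \<beta> \<rho> a c n =
     (1 / real n) * ln (grand_partition \<beta> \<rho> (exp_interaction a c n) n)"

definition pressure :: "real \<Rightarrow> real \<Rightarrow> real \<Rightarrow> real \<Rightarrow> real" where
  "pressure \<beta> \<rho> a c = (1 / \<beta>) * lim (pressure_seq \<beta> \<rho> a c)"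

text \<open>
  The integral over the unit square of the kernel \<open>exp (- a * \<bar>y - z\<bar>) / (2 * a)\<close>, in closed form.
\<close>

definition kernel_mean :: "real \<Rightarrow> real" where
  "kernel_mean a = (1 / a ^ 3) * (a + exp (- a) - 1)"

text \<open>
  The poles of \<open>tan\<close> contribute no spurious roots, since \<open>tan\<close> takes the value \<open>0\<close> there.
\<close>

definition smallest_root :: "real \<Rightarrow> real" where
  "smallest_root a = (LEAST y. y > 0 \<and> y * tan (1 / 2 * a * y) = 1)"

text \<open>
  The largest eigenvalue of the integral operator on \<open>L\<^sup>2[0,1]\<close> with the kernel above, in terms
  of the smallest positive root.
\<close>

definition top_eigenvalue :: "real \<Rightarrow> real" where
  "top_eigenvalue a = 1 / (a\<^sup>2 * (1 + (smallest_root a)\<^sup>2))"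

text \<open>The convention \<open>0 log 0 = 0\<close> holds automatically at \<open>x = 0\<close> and \<open>x = 1\<close>.\<close>

definition vdw_functional :: "real \<Rightarrow> real \<Rightarrow> real \<Rightarrow> real \<Rightarrow> real" where
  "vdw_functional \<rho> \<beta> \<alpha> x =
     x * ln \<rho> + \<alpha> * \<beta> * x\<^sup>2 - x * ln x - (1 - x) * ln (1 - x)"

end

theory Submission
  imports Defs "HOL-Real_Asymp.Real_Asymp"
begin

text \<open>
  Everything rests on the kernel \<open>q\<^bsup>|i-j|\<^esup>\<close> being positive semidefinite.

  Existence of the limit: convexity of the energy decouples the \<open>m\<close> interleaved sublattices of a
  system of \<open>n m\<close> sites, so that \<open>log Z\<^bsub>nm\<^esub> \<le> m (log Z\<^bsub>n\<^esub> + C)\<close>; hence \<open>(log Z\<^bsub>n\<^esub>) / n\<close> is decreasing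
  up to \<open>O(1 / n)\<close>.

  Upper bound: in a system of \<open>n\<^sup>2\<close> sites the interaction is almost constant on blocks of length \<open>n\<close>,
  and bounding \<open>2 N\<^sub>k N\<^sub>l\<close> by \<open>N\<^sub>k\<^sup>2 + N\<^sub>l\<^sup>2\<close> for the block occupations decouples the blocks into
  Curie--Weiss models. Since the row sums of the interaction tend to at most \<open>2 c / a\<^sup>2 = 2 \<alpha>\<close>,
  \<open>\<beta> p\<close> is at most the maximum \<open>F d\<close> of the van der Waals functional, for every \<open>a\<close>.

  Lower bound: the energy of the occupation numbers minus \<open>d\<close> is nonnegative, so the energy is bounded
  below by an affine function of the occupation numbers; this gives
  \<open>\<beta> p \<ge> F d - \<beta> d\<^sup>2 (\<alpha> - c k(a))\<close>. The two bounds meet since \<open>c k(a)\<close> tends to \<open>\<alpha>\<close>.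
\<close>

section \<open>Toeplitz quadratic forms with kernel \<open>q\<^bsup>|i-j|\<^esup>\<close>\<close>

text \<open>Subtraction on \<open>nat\<close> truncates, so \<open>(i - j) + (j - i)\<close> is the
  distance \<open>|i - j|\<close>.\<close>

definition toeplitz_form :: "real \<Rightarrow> nat \<Rightarrow> (nat \<Rightarrow> real) \<Rightarrow> (nat \<Rightarrow> real) \<Rightarrow> real" where
  "toeplitz_form q n x y = (\<Sum>i<n. \<Sum>j<n. q ^ ((i - j) + (j - i)) * x i * y j)"

lemma toeplitz_form_sum_left:
  "toeplitz_form q n (\<lambda>i. \<Sum>r\<in>R. x r i) y = (\<Sum>r\<in>R. toeplitz_form q n (x r) y)"
proof -
  have "toeplitz_form q n (\<lambda>i. \<Sum>r\<in>R. x r i) y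
      = (\<Sum>i<n. \<Sum>j<n. \<Sum>r\<in>R. q ^ ((i - j) + (j - i)) * x r i * y j)"
    unfolding toeplitz_form_def by (simp add: sum_distrib_left sum_distrib_right)
  also have "\<dots> = (\<Sum>i<n. \<Sum>r\<in>R. \<Sum>j<n. q ^ ((i - j) + (j - i)) * x r i * y j)"
    by (intro sum.cong refl sum.swap)
  also have "\<dots> = (\<Sum>r\<in>R. toeplitz_form q n (x r) y)"
    unfolding toeplitz_form_def by (rule sum.swap)
  finally show ?thesis .
qed

lemma toeplitz_form_commute: "toeplitz_form q n x y = toeplitz_form q n y x"
proof -
  have "toeplitz_form q n x y = (\<Sum>j<n. \<Sum>i<n. q ^ ((i - j) + (j - i)) * x i * y j)"
    unfolding toeplitz_form_def by (rule sum.swap)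
  thus ?thesis unfolding toeplitz_form_def by (simp add: mult_ac add.commute)
qed

lemma toeplitz_form_diff:
  "toeplitz_form q n (\<lambda>i. x i - y i) (\<lambda>i. x i - y i)
    = toeplitz_form q n x x + toeplitz_form q n y y - 2 * toeplitz_form q n x y"
proof -
  have "toeplitz_form q n (\<lambda>i. x i - y i) (\<lambda>i. x i - y i)
    = toeplitz_form q n x x + toeplitz_form q n y y
      - (toeplitz_form q n x y + toeplitz_form q n y x)"
    unfolding toeplitz_form_def sum_subtractf[symmetric] sum.distrib[symmetric]
    by (intro sum.cong refl) (simp add: algebra_simps)
  thus ?thesis using toeplitz_form_commute[of q n y x] by simp
qed

text \<open>Peeling off the last site yields the recursion behind both positivity and the closed
  form for constant vectors.\<close>

lemma toeplitz_form_Suc: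
  "toeplitz_form q (Suc n) x x
    = toeplitz_form q n x x + 2 * x n * (\<Sum>i<n. q ^ (n - i) * x i) + (x n)\<^sup>2"
proof -
  have "toeplitz_form q (Suc n) x x = toeplitz_form q n x x
      + (\<Sum>i<n. q ^ ((i - n) + (n - i)) * x i * x n)
      + (\<Sum>j<n. q ^ ((n - j) + (j - n)) * x n * x j) + (x n)\<^sup>2"
    unfolding toeplitz_form_def
    by (simp add: sum.distrib power2_eq_square)
  also have "(\<Sum>i<n. q ^ ((i - n) + (n - i)) * x i * x n) = x n * (\<Sum>i<n. q ^ (n - i) * x i)"
    unfolding sum_distrib_left by (intro sum.cong refl) (simp add: mult_ac)
  also have "(\<Sum>j<n. q ^ ((n - j) + (j - n)) * x n * x j) = x n * (\<Sum>i<n. q ^ (n - i) * x i)"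
    unfolding sum_distrib_left by (intro sum.cong refl) (simp add: mult_ac)
  finally show ?thesis by simp
qed

text \<open>Positivity alone is too weak for the induction; the claim is strengthened to
  \<open>(t n)^2 \<le> toeplitz_form q n x x\<close>, where \<open>t n\<close> couples the next site
  to all earlier ones. The recursion then completes the square \<open>(t n + x n)^2\<close>, and the
  factor \<open>q \<le> 1\<close> is absorbed.\<close>

lemma toeplitz_form_nonneg:
  assumes "0 \<le> q" "q \<le> 1"
  shows "0 \<le> toeplitz_form q n x x"
proof -
  define t where "t n = (\<Sum>i<n. q ^ (n - i) * x i)" for n
  have t_Suc: "t (Suc n) = q * (t n + x n)" for n
    unfolding t_def by (simp add: sum_distrib_left Suc_diff_le algebra_simps)
  \<comment> \<open>\<open>t n / q\<close> is the autoregressive sum \<open>s = q s' + x\<close>, in terms of which the form is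
    \<open>(1 - q\<^sup>2)\<close> times a sum of squares plus the square of the last term.\<close>
  have "(t n)\<^sup>2 \<le> toeplitz_form q n x x"
  proof (induction n)
    case 0
    show ?case by (simp add: t_def toeplitz_form_def)
  next
    case (Suc n)
    have "(t (Suc n))\<^sup>2 = q\<^sup>2 * (t n + x n)\<^sup>2" by (simp add: t_Suc power_mult_distrib)
    also have "\<dots> \<le> 1 * (t n + x n)\<^sup>2"
      using assms by (intro mult_right_mono) (auto simp: power_le_one)
    also have "\<dots> = (t n)\<^sup>2 + 2 * x n * t n + (x n)\<^sup>2" by (simp add: power2_sum)
    also have "\<dots> \<le> toeplitz_form q (Suc n) x x"
      using Suc.IH by (simp add: toeplitz_form_Suc t_def)
    finally show ?case .
  qed
  thus ?thesis by (meson order_trans zero_le_power2)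
qed

text \<open>Jensen's inequality for a positive semidefinite form: summing the nonnegative values at
  all differences \<open>y r - y s\<close> and expanding gives twice the right side minus twice the
  left side.\<close>

lemma toeplitz_form_sum_le:
  fixes m :: nat
  assumes "0 \<le> q" "q \<le> 1"
  shows "toeplitz_form q n (\<lambda>i. \<Sum>r<m. y r i) (\<lambda>i. \<Sum>r<m. y r i)
    \<le> m * (\<Sum>r<m. toeplitz_form q n (y r) (y r))"
proof -
  let ?B = "\<lambda>r s. toeplitz_form q n (y r) (y s)"
  have "0 \<le> (\<Sum>r<m. \<Sum>s<m. toeplitz_form q n (\<lambda>i. y r i - y s i) (\<lambda>i. y r i - y s i))"
    by (intro sum_nonneg toeplitz_form_nonneg assms)
  also have "\<dots> = (\<Sum>r<m. \<Sum>s<m. ?B r r) + (\<Sum>r<m. \<Sum>s<m. ?B s s) - 2 * (\<Sum>r<m. \<Sum>s<m. ?B r s)"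
    unfolding toeplitz_form_diff by (simp add: sum_subtractf sum.distrib sum_distrib_left)
  also have "(\<Sum>r<m. \<Sum>s<m. ?B r s) = toeplitz_form q n (\<lambda>i. \<Sum>r<m. y r i) (\<lambda>i. \<Sum>r<m. y r i)"
    unfolding toeplitz_form_sum_left
    by (simp add: toeplitz_form_commute[of q n _ "\<lambda>i. \<Sum>r<m. y r i"] toeplitz_form_sum_left)
       (simp add: toeplitz_form_commute)
  finally show ?thesis by (simp add: sum_distrib_left[symmetric])
qed

section \<open>Coarse graining into blocks and row-sum bounds\<close>

lemma sum_lessThan_mult:
  fixes f :: "nat \<Rightarrow> 'a::comm_monoid_add"
  shows "(\<Sum>i<n * m. f i) = (\<Sum>k<n. \<Sum>r<m. f (k * m + r))"
proof -
  have "(\<Sum>r<m. f (k * m + r)) = sum f {k * m ..< k * m + m}" for k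
    using sum.shift_bounds_nat_ivl[of f 0 "k * m" m] by (simp add: lessThan_atLeast0 add.commute)
  thus ?thesis by (simp add: sum.nat_group)
qed

text \<open>Sites in blocks \<open>k\<close> and \<open>l\<close> of length \<open>m\<close> are at
  distance at least \<open>m * |k - l| - m\<close>, so the kernel may be replaced by a power of
  \<open>q ^ m\<close> depending on the block indices only, at the price of the factor
  \<open>1 / q ^ m\<close>. Nonnegative entries allow the replacement term by term.\<close>

lemma toeplitz_form_coarse_grain:
  assumes q: "0 < q" "q \<le> 1" and x: "\<And>i. 0 \<le> x i"
  shows "toeplitz_form q (n * m) x x
    \<le> (1 / q ^ m) * toeplitz_form (q ^ m) n (\<lambda>k. \<Sum>r<m. x (k * m + r)) (\<lambda>k. \<Sum>r<m. x (k * m + r))"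
proof -
  let ?d = "\<lambda>i j::nat. (i - j) + (j - i)"
  have key: "q ^ ?d (k * m + r) (l * m + s) \<le> (1 / q ^ m) * (q ^ m) ^ ?d k l"
    if "r < m" "s < m" for k l r s
  proof -
    have "m * ?d k l \<le> ?d (k * m + r) (l * m + s) + m"
    proof (cases "k \<le> l")
      case True
      then obtain e where "l = k + e" using le_Suc_ex by blast
      thus ?thesis using that by (simp add: algebra_simps)
    next
      case False
      then obtain e where "k = l + e" using le_Suc_ex nat_le_linear by blast
      thus ?thesis using that by (simp add: algebra_simps)
    qed
    hence "q ^ (?d (k * m + r) (l * m + s) + m) \<le> q ^ (m * ?d k l)"
      using q by (intro power_decreasing) auto
    thus ?thesis using q by (simp add: power_add power_mult field_simps)
  qed
  have "toeplitz_form q (n * m) x x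
      = (\<Sum>k<n. \<Sum>r<m. \<Sum>l<n. \<Sum>s<m. q ^ ?d (k * m + r) (l * m + s) * x (k * m + r) * x (l * m + s))"
    unfolding toeplitz_form_def by (simp only: sum_lessThan_mult)
  also have "\<dots> \<le> (\<Sum>k<n. \<Sum>r<m. \<Sum>l<n. \<Sum>s<m.
      (1 / q ^ m) * (q ^ m) ^ ?d k l * x (k * m + r) * x (l * m + s))"
    using key x by (intro sum_mono mult_right_mono) auto
  also have "\<dots> = (\<Sum>k<n. \<Sum>l<n. \<Sum>r<m. \<Sum>s<m.
      (1 / q ^ m) * (q ^ m) ^ ?d k l * x (k * m + r) * x (l * m + s))"
    by (intro sum.cong refl sum.swap)
  also have "\<dots> = (1 / q ^ m) * toeplitz_form (q ^ m) n (\<lambda>k. \<Sum>r<m. x (k * m + r)) (\<lambda>k. \<Sum>r<m. x (k * m + r))"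
    unfolding toeplitz_form_def mult.assoc unfolding sum_product unfolding sum_distrib_left ..
  finally show ?thesis .
qed

lemma toeplitz_row_sum_le:
  fixes q :: real
  assumes "0 \<le> q" "q < 1"
  shows "(\<Sum>j<n. q ^ ((i - j) + (j - i))) \<le> 2 / (1 - q)"
proof -
  have geo: "(\<Sum>j<k. q ^ j) \<le> 1 / (1 - q)" for k
    using assms by (simp add: sum_gp_strict divide_right_mono)
  \<comment> \<open>With \<open>i + n\<close> columns the row always reaches past the diagonal and
    splits there without a case distinction.\<close>
  have "(\<Sum>j<n. q ^ ((i - j) + (j - i))) \<le> (\<Sum>j<i + n. q ^ ((i - j) + (j - i)))"
    using assms by (intro sum_mono2) auto
  also have "\<dots> = (\<Sum>j<i. q ^ (i - j)) + (\<Sum>j<n. q ^ j)"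
    by (induction n) (simp_all add: add.assoc)
  \<comment> \<open>Giving away one factor \<open>q\<close> makes both halves geometric sums
    starting at exponent 0; the relative loss disappears as \<open>q\<close> tends to 1.\<close>
  also have "(\<Sum>j<i. q ^ (i - j)) \<le> (\<Sum>j<i. q ^ (i - Suc j))"
    using assms by (intro sum_mono power_decreasing) auto
  also have "(\<Sum>j<i. q ^ (i - Suc j)) = (\<Sum>j<i. q ^ j)"
    by (rule sum.nat_diff_reindex)
  finally show ?thesis using geo[of i] geo[of n] by simp
qed

text \<open>Schur test: \<open>2 * x i * x j \<le> (x i)^2 + (x j)^2\<close> for each pair, then
  symmetry and the uniform row-sum bound.\<close>

lemma toeplitz_form_le_sum_squares:
  assumes "0 \<le> q" "q < 1"
  shows "toeplitz_form q n x x \<le> 2 / (1 - q) * (\<Sum>k<n. (x k)\<^sup>2)"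
proof -
  let ?w = "\<lambda>i j::nat. q ^ ((i - j) + (j - i))"
  have "toeplitz_form q n x x \<le> (\<Sum>i<n. \<Sum>j<n. ?w i j * (x i)\<^sup>2 / 2 + ?w i j * (x j)\<^sup>2 / 2)"
    unfolding toeplitz_form_def
  proof (intro sum_mono)
    fix i j :: nat
    have "x i * x j \<le> ((x i)\<^sup>2 + (x j)\<^sup>2) / 2"
      using sum_squares_bound[of "x i" "x j"] by (simp add: field_simps)
    hence "?w i j * (x i * x j) \<le> ?w i j * (((x i)\<^sup>2 + (x j)\<^sup>2) / 2)"
      using assms by (intro mult_left_mono) auto
    thus "?w i j * x i * x j \<le> ?w i j * (x i)\<^sup>2 / 2 + ?w i j * (x j)\<^sup>2 / 2"
      by (simp add: algebra_simps add_divide_distrib)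
  qed
  also have "\<dots> = (\<Sum>i<n. \<Sum>j<n. ?w i j * (x i)\<^sup>2 / 2) + (\<Sum>j<n. \<Sum>i<n. ?w i j * (x j)\<^sup>2 / 2)"
    by (subst (2) sum.swap) (simp add: sum.distrib)
  also have "\<dots> = (\<Sum>i<n. (\<Sum>j<n. ?w i j) * (x i)\<^sup>2)"
  proof -
    have "(\<Sum>j<n. ?w i j * (x i)\<^sup>2 / 2) = (\<Sum>j<n. ?w i j) * (x i)\<^sup>2 / 2" for i
      by (simp only: sum_distrib_right sum_divide_distrib)
    moreover have "(\<Sum>i<n. ?w i j * (x j)\<^sup>2 / 2) = (\<Sum>i<n. ?w j i) * (x j)\<^sup>2 / 2" for j
      by (simp only: sum_distrib_right sum_divide_distrib add.commute[of "_ - j"])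
    ultimately show ?thesis
      by (simp only: sum_divide_distrib[symmetric])
  qed
  also have "\<dots> \<le> (\<Sum>i<n. 2 / (1 - q) * (x i)\<^sup>2)"
    by (intro sum_mono mult_right_mono toeplitz_row_sum_le assms) auto
  finally show ?thesis by (simp add: sum_distrib_left)
qed

text \<open>This is the energy of full occupation. For \<open>q = exp (- a / n)\<close>, divided by
  \<open>n^2\<close>, it is a discrete version of the integral of \<open>exp (- a * |y - z|)\<close>
  over the unit square, which is \<open>2 * a * kernel_mean a\<close>.\<close>

lemma toeplitz_form_one:
  assumes "q \<noteq> 1"
  shows "toeplitz_form q n (\<lambda>_. 1) (\<lambda>_. 1) = (n * (1 - q\<^sup>2) - 2 * q * (1 - q ^ n)) / (1 - q)\<^sup>2"
proof (induction n)
  case 0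
  show ?case by (simp add: toeplitz_form_def)
next
  case (Suc n)
  have "(\<Sum>i<n. q ^ (n - i)) = q * (\<Sum>i<n. q ^ (n - Suc i))"
    unfolding sum_distrib_left by (intro sum.cong refl) (simp flip: power_Suc add: Suc_diff_Suc)
  also have "(\<Sum>i<n. q ^ (n - Suc i)) = (\<Sum>j<n. q ^ j)"
    by (rule sum.nat_diff_reindex)
  also have "\<dots> = (1 - q ^ n) / (1 - q)" using assms by (simp add: sum_gp_strict)
  finally have "toeplitz_form q (Suc n) (\<lambda>_. 1) (\<lambda>_. 1)
     = (n * (1 - q\<^sup>2) - 2 * q * (1 - q ^ n)) / (1 - q)\<^sup>2 + 2 * (q * ((1 - q ^ n) / (1 - q))) + 1"
    by (simp add: toeplitz_form_Suc Suc.IH)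
  also have "\<dots> = (Suc n * (1 - q\<^sup>2) - 2 * q * (1 - q ^ Suc n)) / (1 - q)\<^sup>2"
    using assms by (simp add: divide_simps power2_eq_square) (simp add: algebra_simps)
  finally show ?case .
qed

section \<open>The lattice gas with self-interaction\<close>

definition occupation :: "nat set \<Rightarrow> nat \<Rightarrow> real" where
  "occupation S i = of_bool (i \<in> S)"

definition toeplitz_energy :: "real \<Rightarrow> nat \<Rightarrow> nat set \<Rightarrow> real" where
  "toeplitz_energy q n S = toeplitz_form q n (occupation S) (occupation S)"

text \<open>
  Compared with the lattice gas, the energy contains the diagonal terms \<open>i = j\<close>, which make it
  positive semidefinite; for the coupling \<open>b\<close> of order \<open>1 / n\<close> this changes the
  partition function by a bounded factor only.
\<close>

definition toeplitz_partition :: "real \<Rightarrow> real \<Rightarrow> real \<Rightarrow> nat \<Rightarrow> real" where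
  "toeplitz_partition b q \<rho> n = (\<Sum>S\<in>Pow {..<n}. \<rho> ^ card S * exp (b * toeplitz_energy q n S))"

lemma sum_occupation:
  assumes "finite A" "S \<subseteq> A"
  shows "(\<Sum>i\<in>A. f i * occupation S i) = sum f S"
proof -
  have "sum f S = (\<Sum>i\<in>A. if i \<in> S then f i else 0)"
    using assms by (simp add: sum.inter_restrict[symmetric] Int_absorb1)
  also have "\<dots> = (\<Sum>i\<in>A. f i * occupation S i)"
    by (intro sum.cong) (auto simp: occupation_def)
  finally show ?thesis by simp
qed

lemma toeplitz_energy_eq_pairs:
  assumes "S \<subseteq> {..<n}"
  shows "toeplitz_energy q n S = 2 * (\<Sum>(i, j)\<in>{(i, j)\<in>S \<times> S. i < j}. q ^ (j - i)) + card S"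
proof -
  have fin: "finite S" using assms finite_subset by blast
  let ?w = "\<lambda>(i, j). q ^ ((i - j) + (j - i))"
  have "toeplitz_energy q n S = (\<Sum>i<n. (\<Sum>j\<in>S. ?w (i, j)) * occupation S i)"
    unfolding toeplitz_energy_def toeplitz_form_def
    by (intro sum.cong refl, subst sum_occupation[symmetric, OF _ assms])
       (simp_all add: sum_distrib_left sum_distrib_right mult_ac)
  also have "\<dots> = (\<Sum>i\<in>S. \<Sum>j\<in>S. ?w (i, j))"
    by (subst sum_occupation[OF _ assms]) auto
  also have "\<dots> = sum ?w (S \<times> S)" by (simp add: sum.cartesian_product)
  also have "S \<times> S = {(i, j)\<in>S \<times> S. i < j} \<union> {(i, j)\<in>S \<times> S. j < i} \<union> {(i, j)\<in>S \<times> S. i = j}"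
    by auto
  also have "sum ?w \<dots> = sum ?w {(i, j)\<in>S \<times> S. i < j} + sum ?w {(i, j)\<in>S \<times> S. j < i}
      + sum ?w {(i, j)\<in>S \<times> S. i = j}"
    by (subst sum.union_disjoint; (subst sum.union_disjoint)?)
       (auto intro!: finite_subset[OF _ finite_cartesian_product[OF fin fin]])
  also have "sum ?w {(i, j)\<in>S \<times> S. i < j} = (\<Sum>(i, j)\<in>{(i, j)\<in>S \<times> S. i < j}. q ^ (j - i))"
    by (intro sum.cong) auto
  also have "sum ?w {(i, j)\<in>S \<times> S. j < i} = (\<Sum>(i, j)\<in>{(i, j)\<in>S \<times> S. i < j}. q ^ (j - i))"
    by (rule sum.reindex_bij_witness[of _ prod.swap prod.swap]) auto
  also have "sum ?w {(i, j)\<in>S \<times> S. i = j} = (\<Sum>i\<in>S. 1)"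
    by (rule sum.reindex_bij_witness[of _ "\<lambda>i. (i, i)" fst]) auto
  finally show ?thesis by simp
qed

section \<open>Energy bound and comparison with the original lattice gas\<close>

lemma toeplitz_energy_le:
  assumes "0 \<le> q" "q \<le> 1"
  shows "toeplitz_energy q n S \<le> real n ^ 2"
proof -
  have "toeplitz_energy q n S \<le> (\<Sum>i<n. \<Sum>j<n. 1)"
    unfolding toeplitz_energy_def toeplitz_form_def
    by (intro sum_mono) (use assms in \<open>auto simp: occupation_def intro!: power_le_one\<close>)
  thus ?thesis by (simp add: power2_eq_square)
qed

text \<open>The choice \<open>q = exp (- a / n)\<close> turns the interaction into the Toeplitz
  kernel. The 2 in the denominator undoes the double counting of pairs, and \<open>card S\<close>
  removes the diagonal.\<close>

lemma configuration_energy_exp_interaction: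
  assumes "S \<subseteq> {..<n}"
  shows "configuration_energy (exp_interaction a c n) S
    = - (c / (2 * a * n)) * (toeplitz_energy (exp (- a / n)) n S - card S)"
proof -
  have "configuration_energy (exp_interaction a c n) S
    = - (c / (a * n)) * (\<Sum>(i, j)\<in>{(i, j)\<in>S \<times> S. i < j}. exp (- a / n) ^ (j - i))"
    unfolding configuration_energy_def exp_interaction_def sum_distrib_left
    by (intro sum.cong refl)
       (auto simp: exp_of_nat_mult[symmetric] of_nat_diff field_simps)
  thus ?thesis unfolding toeplitz_energy_eq_pairs[OF assms] by (simp add: field_simps)
qed

text \<open>Configuration by configuration, the weights differ by the exponential of the coupling
  times \<open>card S\<close>, an exponent between 0 and \<open>\<beta> * c / (2 * a)\<close>
  because \<open>card S \<le> n\<close>.\<close>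

lemma grand_partition_le_toeplitz_partition:
  assumes "\<beta> > 0" "\<rho> > 0" "a > 0" "c > 0"
  shows "grand_partition \<beta> \<rho> (exp_interaction a c n) n
      \<le> toeplitz_partition (\<beta> * c / (2 * a) / n) (exp (- a / n)) \<rho> n" (is ?upper)
    and "toeplitz_partition (\<beta> * c / (2 * a) / n) (exp (- a / n)) \<rho> n
      \<le> exp (\<beta> * c / (2 * a)) * grand_partition \<beta> \<rho> (exp_interaction a c n) n" (is ?lower)
proof -
  let ?b = "\<beta> * c / (2 * a) / n"
  have e: "- \<beta> * configuration_energy (exp_interaction a c n) S
      = ?b * toeplitz_energy (exp (- a / n)) n S - ?b * card S" if "S \<subseteq> {..<n}" for S
    unfolding configuration_energy_exp_interaction[OF that]
    by (simp add: right_diff_distrib diff_divide_distrib mult_ac)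
  have card: "0 \<le> ?b * card S" "?b * card S \<le> \<beta> * c / (2 * a)" if "S \<subseteq> {..<n}" for S
  proof -
    show "0 \<le> ?b * card S" using assms by simp
    have "card S \<le> n" using that by (metis card_lessThan card_mono finite_lessThan)
    hence "?b * card S \<le> ?b * n" using assms by (intro mult_left_mono) auto
    \<comment> \<open>For \<open>n = 0\<close> the coupling is 0, since division by zero yields
      0.\<close>
    also have "\<dots> \<le> \<beta> * c / (2 * a)" using assms by (cases "n = 0") auto
    finally show "?b * card S \<le> \<beta> * c / (2 * a)" .
  qed
  show ?upper
    unfolding grand_partition_def toeplitz_partition_def lessThan_atLeast0[symmetric]
  proof (intro sum_mono mult_left_mono)
    fix S assume "S \<in> Pow {..<n}"
    thus "exp (- \<beta> * configuration_energy (exp_interaction a c n) S)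
        \<le> exp (?b * toeplitz_energy (exp (- a / n)) n S)"
      using e[of S] card[of S] by simp
  qed (use assms in auto)
  show ?lower
    unfolding grand_partition_def toeplitz_partition_def lessThan_atLeast0[symmetric] sum_distrib_left
      mult.left_commute[of "exp (\<beta> * c / (2 * a))"]
  proof (intro sum_mono mult_left_mono)
    fix S assume "S \<in> Pow {..<n}"
    thus "exp (?b * toeplitz_energy (exp (- a / n)) n S)
        \<le> exp (\<beta> * c / (2 * a)) * exp (- \<beta> * configuration_energy (exp_interaction a c n) S)"
      using e[of S] card[of S] by (simp flip: exp_add)
  qed (use assms in auto)
qed

text \<open>The empty configuration alone contributes 1. This keeps all later logarithms nonnegative
  and justifies their monotonicity.\<close>

lemma one_le_grand_partition:
  assumes "\<rho> > 0"
  shows "1 \<le> grand_partition \<beta> \<rho> \<epsilon> n"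
proof -
  have "1 = (\<Sum>S\<in>{{}}. \<rho> ^ card S * exp (- \<beta> * configuration_energy \<epsilon> S))"
    by (simp add: configuration_energy_def)
  also have "\<dots> \<le> grand_partition \<beta> \<rho> \<epsilon> n"
    unfolding grand_partition_def using assms by (intro sum_mono2) auto
  finally show ?thesis .
qed

text \<open>The sets \<open>f r\<close> indexed by \<open>r\<close> cover \<open>X\<close>, so a
  configuration is determined by its traces on them. The map to families of traces is therefore
  injective, and enlarging the sum to all families makes it factorize.\<close>

lemma sum_Pow_prod_le:
  fixes g :: "'k set \<Rightarrow> real"
  assumes fin: "finite I" "finite K" and cover: "X \<subseteq> (\<lambda>(r, k). f r k) ` (I \<times> K)"
    and g: "\<And>U. 0 \<le> g U"
  shows "(\<Sum>S\<in>Pow X. \<Prod>r\<in>I. g {k\<in>K. f r k \<in> S}) \<le> (\<Sum>U\<in>Pow K. g U) ^ card I"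
proof -
  let ?h = "\<lambda>S. \<lambda>r\<in>I. {k\<in>K. f r k \<in> S}"
  have inj: "inj_on ?h (Pow X)"
  proof (rule inj_onI)
    fix S S' assume S: "S \<in> Pow X" "S' \<in> Pow X" and eq: "?h S = ?h S'"
    have "x \<in> S \<longleftrightarrow> x \<in> S'" if x: "x \<in> X" for x
    proof -
      obtain r k where "r \<in> I" "k \<in> K" "x = f r k" using cover x by auto
      moreover have "{k\<in>K. f r k \<in> S} = {k\<in>K. f r k \<in> S'}"
        using fun_cong[OF eq, of r] \<open>r \<in> I\<close> by simp
      ultimately show ?thesis by auto
    qed
    thus "S = S'" using S by blast
  qed
  have "(\<Sum>S\<in>Pow X. \<Prod>r\<in>I. g {k\<in>K. f r k \<in> S}) = (\<Sum>h\<in>?h ` Pow X. \<Prod>r\<in>I. g (h r))"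
    by (subst sum.reindex[OF inj]) (auto intro!: sum.cong prod.cong)
  also have "\<dots> \<le> (\<Sum>h\<in>PiE I (\<lambda>_. Pow K). \<Prod>r\<in>I. g (h r))"
    using fin g by (intro sum_mono2 finite_PiE prod_nonneg) (auto simp: PiE_iff)
  also have "\<dots> = (\<Prod>r\<in>I. \<Sum>U\<in>Pow K. g U)"
    using fin by (subst prod_sum_PiE) auto
  finally show ?thesis by simp
qed

section \<open>The van der Waals functional\<close>

text \<open>Nonnegativity of the relative entropy of the Bernoulli law with parameter
  \<open>x\<close> with respect to the one with weights \<open>exp s / A\<close> and
  \<open>1 / A\<close>; it follows from \<open>ln u \<le> u - 1\<close> at the two likelihood
  ratios. The endpoints are treated apart, where a ratio would divide by zero.\<close>

lemma gibbs_variational_le: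
  fixes x s :: real
  assumes "0 \<le> x" "x \<le> 1"
  shows "x * s - x * ln x - (1 - x) * ln (1 - x) \<le> ln (1 + exp s)"
proof (cases "x = 0 \<or> x = 1")
  case True
  thus ?thesis
  proof
    assume "x = 1"
    have "s = ln (exp s)" by simp
    also have "\<dots> \<le> ln (1 + exp s)" by (subst ln_le_cancel_iff) (auto intro: add_pos_pos)
    finally show ?thesis using \<open>x = 1\<close> by simp
  qed auto
next
  case False
  hence x: "0 < x" "x < 1" using assms by auto
  define A where "A = 1 + exp s"
  have A: "A > 0" by (simp add: A_def add_pos_pos)
  have "x * (s - ln A - ln x) = x * ln (exp s / (A * x))"
    using x A by (simp add: ln_div ln_mult)
  also have "\<dots> \<le> x * (exp s / (A * x) - 1)"
    using x A by (intro mult_left_mono ln_le_minus_one) auto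
  finally have 1: "x * (s - ln A - ln x) \<le> exp s / A - x" using x by (simp add: field_simps)
  have "(1 - x) * (- ln A - ln (1 - x)) = (1 - x) * ln (1 / (A * (1 - x)))"
    using x A by (simp add: ln_div ln_mult)
  also have "\<dots> \<le> (1 - x) * (1 / (A * (1 - x)) - 1)"
    using x A by (intro mult_left_mono ln_le_minus_one) auto
  also have "\<dots> = 1 / A - (1 - x)" using x A by (simp add: divide_simps) (simp add: algebra_simps)?
  finally have 2: "(1 - x) * (- ln A - ln (1 - x)) \<le> 1 / A - (1 - x)" .
  have "exp s / A + 1 / A = 1" using A by (simp add: A_def add_divide_distrib[symmetric] add.commute)
  with 1 2 show ?thesis unfolding A_def[symmetric] by (simp add: algebra_simps)
qed

text \<open>Equality case: at the logistic parameter the two Bernoulli laws coincide.\<close>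

lemma gibbs_variational_eq:
  fixes s :: real
  defines "y \<equiv> exp s / (1 + exp s)"
  shows "ln (1 + exp s) = y * s - y * ln y - (1 - y) * ln (1 - y)"
proof -
  have A: "1 + exp s > 0" by (simp add: add_pos_pos)
  have 1: "ln y = s - ln (1 + exp s)" using A by (simp add: y_def ln_div)
  have "1 - y = 1 / (1 + exp s)" using A by (simp add: y_def field_simps)
  hence 2: "ln (1 - y) = - ln (1 + exp s)" using A by (simp add: ln_div)
  show ?thesis unfolding 1 2 by (simp add: algebra_simps)
qed

text \<open>
  The Legendre dual of the van der Waals functional: both have the same maximum, but this one is
  smooth.
\<close>

definition mean_field :: "real \<Rightarrow> real \<Rightarrow> real \<Rightarrow> real \<Rightarrow> real" where
  "mean_field \<rho> \<beta> \<alpha> x = ln (1 + \<rho> * exp (2 * \<alpha> * \<beta> * x)) - \<alpha> * \<beta> * x\<^sup>2"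

text \<open>Gibbs' inequality in the field \<open>s = ln \<rho> + 2 * \<alpha> * \<beta> * x\<close>
  that the density \<open>x\<close> itself generates.\<close>

lemma vdw_functional_le_mean_field:
  assumes "\<rho> > 0" "0 \<le> x" "x \<le> 1"
  shows "vdw_functional \<rho> \<beta> \<alpha> x \<le> mean_field \<rho> \<beta> \<alpha> x"
  using gibbs_variational_le[of x "ln \<rho> + 2 * \<alpha> * \<beta> * x"] assms
  by (simp add: vdw_functional_def mean_field_def exp_add power2_eq_square algebra_simps)

text \<open>The witness \<open>y\<close> is the density of independent sites in the field generated
  by \<open>x\<close>; the two sides then differ by exactly
  \<open>\<alpha> * \<beta> * (x - y)^2\<close>.\<close>

lemma mean_field_le_vdw_functional:
  assumes "\<rho> > 0" "0 < \<beta>" "0 < \<alpha>"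
  obtains y where "0 \<le> y" "y \<le> 1" "mean_field \<rho> \<beta> \<alpha> x \<le> vdw_functional \<rho> \<beta> \<alpha> y"
proof -
  define s where "s = ln \<rho> + 2 * \<alpha> * \<beta> * x"
  define y where "y = exp s / (1 + exp s)"
  have y: "0 \<le> y" "y \<le> 1" unfolding y_def by (auto simp: divide_le_eq add_pos_pos)
  have "0 \<le> \<alpha> * \<beta> * (x - y)\<^sup>2" using assms by simp
  moreover have "mean_field \<rho> \<beta> \<alpha> x = y * s - y * ln y - (1 - y) * ln (1 - y) - \<alpha> * \<beta> * x\<^sup>2"
    unfolding mean_field_def
    using gibbs_variational_eq[of s] assms(1) by (simp add: y_def s_def exp_add)
  ultimately have "mean_field \<rho> \<beta> \<alpha> x \<le> vdw_functional \<rho> \<beta> \<alpha> y"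
    unfolding vdw_functional_def s_def by (simp add: power2_eq_square algebra_simps)
  with y that show ?thesis by blast
qed

text \<open>Compactness is applied to the continuous dual \<open>mean_field\<close>, which avoids
  the logarithms at the endpoints; the two comparisons carry its maximum over to a point
  \<open>y\<close> for the functional itself.\<close>

lemma vdw_functional_has_maximizer:
  assumes "\<rho> > 0" "0 < \<beta>" "0 < \<alpha>"
  shows "\<exists>d. is_arg_max (vdw_functional \<rho> \<beta> \<alpha>) (\<lambda>x. x \<in> {0..1}) d"
proof -
  have "1 + \<rho> * exp (2 * \<alpha> * \<beta> * x) \<noteq> 0" for x
    using assms by (smt (verit) exp_gt_zero mult_pos_pos)
  hence "continuous_on {0..1} (mean_field \<rho> \<beta> \<alpha>)"
    unfolding mean_field_def by (intro continuous_intros) auto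
  then obtain x where x: "x \<in> {0..1}" "\<forall>z\<in>{0..1}. mean_field \<rho> \<beta> \<alpha> z \<le> mean_field \<rho> \<beta> \<alpha> x"
    using continuous_attains_sup[of "{0..1::real}" "mean_field \<rho> \<beta> \<alpha>"] by auto
  obtain y where y: "0 \<le> y" "y \<le> 1" "mean_field \<rho> \<beta> \<alpha> x \<le> vdw_functional \<rho> \<beta> \<alpha> y"
    using mean_field_le_vdw_functional[OF assms] by blast
  have "vdw_functional \<rho> \<beta> \<alpha> z \<le> vdw_functional \<rho> \<beta> \<alpha> y" if "z \<in> {0..1}" for z
    using vdw_functional_le_mean_field[OF assms(1), of z] x(2) y(3) that
    by (meson atLeastAtMost_iff order_trans)
  with y(1,2) show ?thesis unfolding is_arg_max_linorder by auto
qed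

text \<open>The entropy has infinite slope at both endpoints, so the maximum is interior, and the
  vanishing derivative there is the density equation.\<close>

lemma vdw_functional_maximizer:
  assumes "\<rho> > 0" "0 < \<beta>" "0 < \<alpha>"
    and max: "is_arg_max (vdw_functional \<rho> \<beta> \<alpha>) (\<lambda>x. x \<in> {0..1}) d"
  shows "0 < d" "d < 1" "\<rho> = exp (- 2 * \<alpha> * \<beta> * d) * (d / (1 - d))"
proof -
  let ?F = "vdw_functional \<rho> \<beta> \<alpha>"
  have d: "0 \<le> d" "d \<le> 1" and le: "\<And>x. 0 \<le> x \<Longrightarrow> x \<le> 1 \<Longrightarrow> ?F x \<le> ?F d"
    using max unfolding is_arg_max_linorder by auto
  have d0: "d \<noteq> 0"
  proof
    assume "d = 0"
    \<comment> \<open>For \<open>x < \<rho>\<close> the difference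
      \<open>x * ln \<rho> - x * ln x\<close> is positive, and the remaining terms of the functional
      are nonnegative.\<close>
    define x where "x = min (\<rho> / 2) (1 / 2)"
    have x: "0 < x" "x < 1" "x < \<rho>" using assms by (auto simp: x_def)
    have "x * ln x < x * ln \<rho>" using x by simp
    moreover have "(1 - x) * ln (1 - x) \<le> 0" using x by (intro mult_nonneg_nonpos) auto
    moreover have "0 \<le> \<alpha> * \<beta> * x\<^sup>2" using assms by simp
    ultimately have "?F 0 < ?F x" by (simp add: vdw_functional_def)
    thus False using le[of x] x \<open>d = 0\<close> by simp
  qed
  have d1: "d \<noteq> 1"
  proof
    assume "d = 1"
    \<comment> \<open>Here \<open>x\<close> is the density of holes: moving from 1 to
      \<open>1 - x\<close> loses \<open>x * (ln \<rho> + 2 * \<alpha> * \<beta>)\<close> to first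
      order, and \<open>x\<close> is small enough for the entropy \<open>- x * ln x\<close> to
      exceed this.\<close>
    define x where "x = min (exp (- (ln \<rho> + 2 * \<alpha> * \<beta>)) / 2) (1 / 2)"
    have x: "0 < x" "x < 1" "x < exp (- (ln \<rho> + 2 * \<alpha> * \<beta>))"
      unfolding x_def using exp_gt_zero[of "- (ln \<rho> + 2 * \<alpha> * \<beta>)"] by linarith+
    have "ln x < - (ln \<rho> + 2 * \<alpha> * \<beta>)" using x by (metis exp_gt_zero ln_exp ln_less_cancel_iff)
    hence "x * ln x < x * - (ln \<rho> + 2 * \<alpha> * \<beta>)" using x by simp
    moreover have "(1 - x) * ln (1 - x) \<le> 0" using x by (intro mult_nonneg_nonpos) auto
    moreover have "0 \<le> \<alpha> * \<beta> * x\<^sup>2" using assms by simp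
    ultimately have "?F 1 < ?F (1 - x)"
      by (simp add: vdw_functional_def power2_eq_square algebra_simps)
    thus False using le[of "1 - x"] x \<open>d = 1\<close> by simp
  qed
  show d': "0 < d" "d < 1" using d d0 d1 by auto
  have deriv: "(?F has_real_derivative
      ln \<rho> + 2 * \<alpha> * \<beta> * d - ln d + ln (1 - d)) (at d)"
    unfolding vdw_functional_def[abs_def]
    by (rule derivative_eq_intros refl | use d' in \<open>simp add: field_simps; fail\<close>)+
  have "ln \<rho> + 2 * \<alpha> * \<beta> * d - ln d + ln (1 - d) = 0"
  proof (rule DERIV_local_max[OF deriv])
    show "0 < min d (1 - d)" using d' by simp
    show "\<forall>y. \<bar>d - y\<bar> < min d (1 - d) \<longrightarrow> ?F y \<le> ?F d"
      using le by (auto simp: abs_if split: if_splits)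
  qed
  hence "ln \<rho> = ln (exp (- 2 * \<alpha> * \<beta> * d) * (d / (1 - d)))"
    using d' by (simp add: ln_mult ln_div)
  thus "\<rho> = exp (- 2 * \<alpha> * \<beta> * d) * (d / (1 - d))"
    using d' assms(1) by (subst (asm) ln_inj_iff) auto
qed

section \<open>Bounds on the partition function\<close>

lemma prod_one_plus_expand:
  fixes f :: "'i \<Rightarrow> real"
  assumes "finite I"
  shows "(\<Prod>i\<in>I. 1 + f i) = (\<Sum>S\<in>Pow I. \<Prod>i\<in>S. f i)"
proof -
  have "(\<Prod>i\<in>I. f i + 1) = (\<Sum>S\<in>Pow I. (\<Prod>i\<in>S. f i) * (\<Prod>i\<in>I - S. 1))"
    by (rule prod_add) fact
  thus ?thesis by (simp add: add.commute)
qed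

lemma sum_Pow_power_card:
  fixes z :: real
  assumes "finite I"
  shows "(\<Sum>S\<in>Pow I. z ^ card S) = (1 + z) ^ card I"
  using prod_one_plus_expand[OF assms, of "\<lambda>_. z"] by simp

lemma card_eq_sum_blocks:
  fixes n m :: nat
  assumes "S \<subseteq> {..<n * m}"
  shows "card S = (\<Sum>k<n. \<Sum>r<m. of_bool (k * m + r \<in> S))"
proof -
  have "card S = (\<Sum>i<n * m. of_bool (i \<in> S))"
    using assms by (simp add: Int_absorb1)
  thus ?thesis by (simp only: sum_lessThan_mult)
qed

lemma sum_occupation_block:
  "(\<Sum>r<m. occupation S (k * m + r)) = card {r\<in>{..<m}. k * m + r \<in> S}"
  unfolding occupation_def by (simp add: Int_def)

text \<open>Division with remainder by \<open>m\<close>, in two orders: the first component of the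
  pair labels the subsystems that decouple, contiguous blocks in the first case and residue classes
  in the second.\<close>

lemma lessThan_mult_subset_blocks:
  fixes n m :: nat
  shows "{..<n * m} \<subseteq> (\<lambda>(k, r). k * m + r) ` ({..<n} \<times> {..<m})"
    and "{..<n * m} \<subseteq> (\<lambda>(r, k). k * m + r) ` ({..<m} \<times> {..<n})"
proof -
  have *: "i div m < n" "i mod m < m" if "i < n * m" for i
  proof -
    have "m > 0" using that by (cases m) auto
    thus "i div m < n" "i mod m < m"
      using that by (auto simp: less_mult_imp_div_less)
  qed
  show "{..<n * m} \<subseteq> (\<lambda>(k, r). k * m + r) ` ({..<n} \<times> {..<m})"
  proof
    fix i assume "i \<in> {..<n * m}"
    thus "i \<in> (\<lambda>(k, r). k * m + r) ` ({..<n} \<times> {..<m})"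
      using *[of i] by (intro image_eqI[of _ _ "(i div m, i mod m)"]) auto
  qed
  show "{..<n * m} \<subseteq> (\<lambda>(r, k). k * m + r) ` ({..<m} \<times> {..<n})"
  proof
    fix i assume "i \<in> {..<n * m}"
    thus "i \<in> (\<lambda>(r, k). k * m + r) ` ({..<m} \<times> {..<n})"
      using *[of i] by (intro image_eqI[of _ _ "(i mod m, i div m)"]) auto
  qed
qed

section \<open>Upper bounds by decoupling\<close>

lemma toeplitz_partition_nonneg: "\<rho> > 0 \<Longrightarrow> 0 \<le> toeplitz_partition b q \<rho> n"
  unfolding toeplitz_partition_def by (intro sum_nonneg) auto

text \<open>The energy never exceeds \<open>n^2\<close>, so a change of coupling of order
  \<open>1 / n^2\<close> costs only a bounded factor.\<close>

lemma toeplitz_partition_change_coupling: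
  assumes "\<rho> > 0" "0 \<le> q" "q \<le> 1" "b \<le> b'"
  shows "toeplitz_partition b' q \<rho> n \<le> exp ((b' - b) * real n ^ 2) * toeplitz_partition b q \<rho> n"
  unfolding toeplitz_partition_def sum_distrib_left mult.left_commute[of "exp ((b' - b) * real n ^ 2)"]
proof (intro sum_mono mult_left_mono)
  fix S
  have "(b' - b) * toeplitz_energy q n S \<le> (b' - b) * real n ^ 2"
    using assms by (intro mult_left_mono toeplitz_energy_le) auto
  thus "exp (b' * toeplitz_energy q n S) \<le> exp ((b' - b) * real n ^ 2) * exp (b * toeplitz_energy q n S)"
    by (simp add: algebra_simps flip: exp_add)
qed (use assms in auto)

text \<open>After coarse graining, the occupation of block \<open>k\<close> is a sum over offsets
  \<open>r\<close> of the occupations of the residue classes, and Jensen's inequality separates the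
  offsets.\<close>

lemma toeplitz_energy_sublattices:
  assumes "0 < q" "q \<le> 1"
  shows "toeplitz_energy q (n * m) S
    \<le> m / q ^ m * (\<Sum>r<m. toeplitz_energy (q ^ m) n {k\<in>{..<n}. k * m + r \<in> S})"
proof -
  have Q: "0 < q ^ m" "q ^ m \<le> 1" using assms by (auto intro: power_le_one)
  let ?X = "\<lambda>k. \<Sum>r<m. occupation S (k * m + r)"
  have "toeplitz_energy q (n * m) S \<le> (1 / q ^ m) * toeplitz_form (q ^ m) n ?X ?X"
    unfolding toeplitz_energy_def
    by (intro toeplitz_form_coarse_grain assms) (simp add: occupation_def)
  also have "\<dots> \<le> (1 / q ^ m) * (m * (\<Sum>r<m. toeplitz_form (q ^ m) n
      (\<lambda>k. occupation S (k * m + r)) (\<lambda>k. occupation S (k * m + r))))"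
    using Q by (intro mult_left_mono toeplitz_form_sum_le) auto
  also have "\<dots> = m / q ^ m * (\<Sum>r<m. toeplitz_energy (q ^ m) n {k\<in>{..<n}. k * m + r \<in> S})"
    unfolding toeplitz_energy_def toeplitz_form_def occupation_def by simp
  finally show ?thesis .
qed

text \<open>
  Sublattice \<open>r\<close> consists of the sites congruent to \<open>r\<close> modulo \<open>m\<close>. Convexity of the positive
  semidefinite energy decouples the \<open>m\<close> sublattices, each of which is a rescaled copy of the
  system with \<open>n\<close> sites.
\<close>

lemma toeplitz_partition_mult_le:
  assumes "\<rho> > 0" "0 \<le> b" "0 < q" "q \<le> 1" "m > 0"
  shows "toeplitz_partition (b / m) q \<rho> (n * m) \<le> toeplitz_partition (b / q ^ m) (q ^ m) \<rho> n ^ m"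
proof -
  let ?S = "\<lambda>S r. {k\<in>{..<n}. k * m + r \<in> S}"
  let ?g = "\<lambda>U. \<rho> ^ card U * exp (b / q ^ m * toeplitz_energy (q ^ m) n U)"
  have "toeplitz_partition (b / m) q \<rho> (n * m) \<le> (\<Sum>S\<in>Pow {..<n * m}. \<Prod>r<m. ?g (?S S r))"
    unfolding toeplitz_partition_def
  proof (intro sum_mono)
    fix S assume "S \<in> Pow {..<n * m}"
    hence S: "S \<subseteq> {..<n * m}" by simp
    have "card S = (\<Sum>r<m. \<Sum>k<n. of_bool (k * m + r \<in> S))"
      unfolding card_eq_sum_blocks[OF S] by (rule sum.swap)
    also have "\<dots> = (\<Sum>r<m. card (?S S r))" by (simp add: Int_def)
    finally have card: "card S = (\<Sum>r<m. card (?S S r))" .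
    \<comment> \<open>The factor \<open>m\<close> from Jensen's inequality cancels the
      \<open>m\<close> in the coupling: the coupling of \<open>n * m\<close> sites is smaller by
      just this factor.\<close>
    have "b / m * toeplitz_energy q (n * m) S
        \<le> b / m * (m / q ^ m * (\<Sum>r<m. toeplitz_energy (q ^ m) n (?S S r)))"
      using assms by (intro mult_left_mono toeplitz_energy_sublattices) auto
    also have "\<dots> = (\<Sum>r<m. b / q ^ m * toeplitz_energy (q ^ m) n (?S S r))"
      using assms by (simp add: sum_distrib_left)
    finally have "exp (b / m * toeplitz_energy q (n * m) S)
        \<le> exp (\<Sum>r<m. b / q ^ m * toeplitz_energy (q ^ m) n (?S S r))"
      by simp
    hence "\<rho> ^ card S * exp (b / m * toeplitz_energy q (n * m) S)
        \<le> \<rho> ^ card S * exp (\<Sum>r<m. b / q ^ m * toeplitz_energy (q ^ m) n (?S S r))"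
      using assms by (intro mult_left_mono) auto
    also have "\<dots> = (\<Prod>r<m. ?g (?S S r))"
      by (simp add: card power_sum exp_sum prod.distrib)
    finally show "\<rho> ^ card S * exp (b / m * toeplitz_energy q (n * m) S) \<le> (\<Prod>r<m. ?g (?S S r))" .
  qed
  also have "\<dots> \<le> (\<Sum>U\<in>Pow {..<n}. ?g U) ^ card {..<m}"
    using assms(1) lessThan_mult_subset_blocks(2)
    by (intro sum_Pow_prod_le[where f = "\<lambda>r k. k * m + r"]) simp_all
  finally show ?thesis by (simp add: toeplitz_partition_def)
qed

text \<open>Coarse graining followed by the Schur test leaves only squares of block occupations, so
  the \<open>n\<close> blocks become independent copies of a system whose energy depends on
  \<open>card U\<close> alone.\<close>

lemma toeplitz_partition_blocks_le:
  assumes "\<rho> > 0" "0 \<le> b" "0 < q" "q < 1" "m > 0"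
  shows "toeplitz_partition b q \<rho> (n * m)
    \<le> (\<Sum>U\<in>Pow {..<m}. \<rho> ^ card U * exp (2 * b / (q ^ m * (1 - q ^ m)) * (card U)\<^sup>2)) ^ n"
proof -
  let ?S = "\<lambda>S k. {r\<in>{..<m}. k * m + r \<in> S}"
  let ?B = "2 * b / (q ^ m * (1 - q ^ m))"
  let ?g = "\<lambda>U. \<rho> ^ card U * exp (?B * (card U)\<^sup>2)"
  have Q: "0 < q ^ m" "q ^ m < 1" using assms by (auto simp: power_less_one_iff)
  have "toeplitz_partition b q \<rho> (n * m) \<le> (\<Sum>S\<in>Pow {..<n * m}. \<Prod>k<n. ?g (?S S k))"
    unfolding toeplitz_partition_def
  proof (intro sum_mono)
    fix S assume "S \<in> Pow {..<n * m}"
    hence S: "S \<subseteq> {..<n * m}" by simp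
    let ?X = "\<lambda>k. \<Sum>r<m. occupation S (k * m + r)"
    have card: "card S = (\<Sum>k<n. card (?S S k))"
      unfolding card_eq_sum_blocks[OF S] by (simp add: Int_def)
    have "toeplitz_energy q (n * m) S \<le> (1 / q ^ m) * toeplitz_form (q ^ m) n ?X ?X"
      unfolding toeplitz_energy_def
      using assms by (intro toeplitz_form_coarse_grain) (auto simp: occupation_def)
    also have "\<dots> \<le> (1 / q ^ m) * (2 / (1 - q ^ m) * (\<Sum>k<n. (?X k)\<^sup>2))"
      using Q by (intro mult_left_mono toeplitz_form_le_sum_squares) auto
    finally have "b * toeplitz_energy q (n * m) S \<le> b * ((1 / q ^ m) * (2 / (1 - q ^ m) * (\<Sum>k<n. (?X k)\<^sup>2)))"
      using assms by (intro mult_left_mono) auto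
    also have "\<dots> = (\<Sum>k<n. ?B * (card (?S S k))\<^sup>2)"
      unfolding sum_occupation_block by (simp add: sum_distrib_left mult_ac)
    finally have "exp (b * toeplitz_energy q (n * m) S) \<le> exp (\<Sum>k<n. ?B * (card (?S S k))\<^sup>2)"
      by simp
    hence "\<rho> ^ card S * exp (b * toeplitz_energy q (n * m) S)
        \<le> \<rho> ^ card S * exp (\<Sum>k<n. ?B * (card (?S S k))\<^sup>2)"
      using assms by (intro mult_left_mono) auto
    also have "\<dots> = (\<Prod>k<n. ?g (?S S k))"
      by (simp only: card power_sum exp_sum[OF finite_lessThan] prod.distrib)
    finally show "\<rho> ^ card S * exp (b * toeplitz_energy q (n * m) S) \<le> (\<Prod>k<n. ?g (?S S k))" .
  qed
  also have "\<dots> \<le> (\<Sum>U\<in>Pow {..<m}. ?g U) ^ card {..<n}"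
    using assms(1) lessThan_mult_subset_blocks(1)
    by (intro sum_Pow_prod_le[where f = "\<lambda>k r. k * m + r"]) simp_all
  finally show ?thesis by simp
qed

text \<open>
  The quadratic exponent is linearized: \<open>u\<^sup>2 / m\<close> is the maximum of \<open>2 x u - m x\<^sup>2\<close>, attained
  at \<open>x = u / m\<close>, which lies on the grid of the \<open>m + 1\<close> points \<open>j / m\<close>.
\<close>

lemma curie_weiss_partition_le:
  assumes "\<rho> > 0" "m > 0" and M: "\<And>x. mean_field \<rho> 1 \<gamma> x \<le> M"
  shows "(\<Sum>U\<in>Pow {..<m}. \<rho> ^ card U * exp (\<gamma> / m * (card U)\<^sup>2)) \<le> (real m + 1) * exp (m * M)"
proof -
  let ?x = "\<lambda>j. real j / real m"
  let ?t = "\<lambda>j u. exp (2 * \<gamma> * ?x j * real u - \<gamma> * m * (?x j)\<^sup>2)"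
  have "(\<Sum>U\<in>Pow {..<m}. \<rho> ^ card U * exp (\<gamma> / m * (card U)\<^sup>2))
      \<le> (\<Sum>U\<in>Pow {..<m}. \<rho> ^ card U * (\<Sum>j\<le>m. ?t j (card U)))"
  proof (intro sum_mono mult_left_mono)
    fix U assume "U \<in> Pow {..<m}"
    hence "card U \<le> m" by (metis PowD card_lessThan card_mono finite_lessThan)
    have "\<gamma> / m * (card U)\<^sup>2 = 2 * \<gamma> * ?x (card U) * real (card U) - \<gamma> * m * (?x (card U))\<^sup>2"
      using assms by (simp add: power2_eq_square field_simps)
    hence "exp (\<gamma> / m * (card U)\<^sup>2) = ?t (card U) (card U)" by simp
    also have "\<dots> \<le> (\<Sum>j\<le>m. ?t j (card U))"
      using \<open>card U \<le> m\<close> by (intro member_le_sum[of "card U" _ "\<lambda>j. ?t j (card U)"]) auto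
    finally show "exp (\<gamma> / m * (card U)\<^sup>2) \<le> (\<Sum>j\<le>m. ?t j (card U))" .
  qed (use assms in auto)
  also have "\<dots> = (\<Sum>j\<le>m. \<Sum>U\<in>Pow {..<m}. \<rho> ^ card U * ?t j (card U))"
    unfolding sum_distrib_left by (rule sum.swap)
  also have "\<dots> \<le> (\<Sum>j\<le>m. exp (m * M))"
  proof (intro sum_mono)
    fix j
    have pos: "0 < 1 + \<rho> * exp (2 * \<gamma> * ?x j)" using assms by (simp add: add_pos_pos)
    have t: "?t j u = exp (2 * \<gamma> * ?x j) ^ u * exp (- \<gamma> * m * (?x j)\<^sup>2)" for u
      by (simp add: mult_ac flip: exp_of_nat_mult exp_add)
    \<comment> \<open>At a fixed grid point the exponent is affine in \<open>card U\<close>: the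
      sites are independent in a constant field, and the sum is a binomial expansion.\<close>
    have "(\<Sum>U\<in>Pow {..<m}. \<rho> ^ card U * ?t j (card U))
        = exp (- \<gamma> * m * (?x j)\<^sup>2) * (\<Sum>U\<in>Pow {..<m}. (\<rho> * exp (2 * \<gamma> * ?x j)) ^ card U)"
      unfolding t sum_distrib_left power_mult_distrib by (simp only: mult_ac)
    also have "\<dots> = exp (- \<gamma> * m * (?x j)\<^sup>2) * (1 + \<rho> * exp (2 * \<gamma> * ?x j)) ^ m"
      by (subst sum_Pow_power_card) auto
    also have "(1 + \<rho> * exp (2 * \<gamma> * ?x j)) ^ m = exp (m * ln (1 + \<rho> * exp (2 * \<gamma> * ?x j)))"
      using pos by (simp add: exp_of_nat_mult)
    also have "exp (- \<gamma> * m * (?x j)\<^sup>2) * \<dots> = exp (m * mean_field \<rho> 1 \<gamma> (?x j))"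
      unfolding mean_field_def by (simp add: algebra_simps flip: exp_add)
    also have "\<dots> \<le> exp (m * M)" using M by (simp add: mult_left_mono)
    finally show "(\<Sum>U\<in>Pow {..<m}. \<rho> ^ card U * ?t j (card U)) \<le> exp (m * M)" .
  qed
  also have "\<dots> = (real m + 1) * exp (m * M)" by simp
  finally show ?thesis .
qed

section \<open>Lower bound by a trial density\<close>

text \<open>Positivity of the form at \<open>occupation S - d\<close> bounds the energy below by an
  affine function of the occupations. This leaves independent sites in the fields
  \<open>2 * b * d * R i\<close>, and Gibbs' inequality is applied to each with the same density
  \<open>d\<close>.\<close>

lemma toeplitz_partition_ge:
  assumes "\<rho> > 0" "0 \<le> b" "0 \<le> q" "q \<le> 1" "0 \<le> d" "d \<le> 1"
  shows "exp (n * (d * ln \<rho> - d * ln d - (1 - d) * ln (1 - d))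
      + b * d\<^sup>2 * toeplitz_form q n (\<lambda>_. 1) (\<lambda>_. 1)) \<le> toeplitz_partition b q \<rho> n"
proof -
  let ?M = "toeplitz_form q n (\<lambda>_. 1) (\<lambda>_. 1)"
  define H where "H = d * ln \<rho> - d * ln d - (1 - d) * ln (1 - d)"
  define R where "R i = (\<Sum>j<n. q ^ ((i - j) + (j - i)))" for i
  have M: "?M = (\<Sum>i<n. R i)" by (simp add: toeplitz_form_def R_def)
  have lin: "2 * d * (\<Sum>i\<in>S. R i) - d\<^sup>2 * ?M \<le> toeplitz_energy q n S" if S: "S \<subseteq> {..<n}" for S
  proof -
    have "toeplitz_form q n (occupation S) (\<lambda>_. d) = (\<Sum>i<n. d * R i * occupation S i)"
      unfolding toeplitz_form_def R_def
      by (intro sum.cong refl) (simp add: sum_distrib_left sum_distrib_right mult_ac)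
    also have "\<dots> = d * (\<Sum>i\<in>S. R i)"
      using S by (subst sum_occupation) (auto simp: sum_distrib_left)
    finally have 1: "toeplitz_form q n (occupation S) (\<lambda>_. d) = d * (\<Sum>i\<in>S. R i)" .
    have 2: "toeplitz_form q n (\<lambda>_. d) (\<lambda>_. d) = d\<^sup>2 * ?M"
      unfolding toeplitz_form_def by (simp add: sum_distrib_left power2_eq_square mult_ac)
    have "0 \<le> toeplitz_form q n (\<lambda>i. occupation S i - d) (\<lambda>i. occupation S i - d)"
      by (intro toeplitz_form_nonneg assms)
    thus ?thesis unfolding toeplitz_form_diff 1 2 toeplitz_energy_def by simp
  qed
  \<comment> \<open>The fields contribute \<open>b * d^2 * ?M\<close> twice and the constant of the
    affine bound removes it once; the remainder is the energy of the uniform density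
    \<open>d\<close>.\<close>
  have "n * H + b * d\<^sup>2 * ?M = (\<Sum>i<n. H + d * (2 * b * d * R i)) - b * d\<^sup>2 * ?M"
    unfolding M by (simp add: sum.distrib sum_distrib_left power2_eq_square algebra_simps)
  also have "\<dots> \<le> (\<Sum>i<n. ln (1 + exp (ln \<rho> + 2 * b * d * R i))) - b * d\<^sup>2 * ?M"
  proof (intro diff_right_mono sum_mono)
    fix i
    show "H + d * (2 * b * d * R i) \<le> ln (1 + exp (ln \<rho> + 2 * b * d * R i))"
      using gibbs_variational_le[OF assms(5,6), of "ln \<rho> + 2 * b * d * R i"]
      by (simp add: H_def algebra_simps)
  qed
  finally have "exp (n * H + b * d\<^sup>2 * ?M)
      \<le> exp ((\<Sum>i<n. ln (1 + exp (ln \<rho> + 2 * b * d * R i))) - b * d\<^sup>2 * ?M)"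
    by simp
  also have "\<dots> = (\<Prod>i<n. 1 + \<rho> * exp (2 * b * d * R i)) * exp (- b * d\<^sup>2 * ?M)"
    using assms(1) by (simp add: exp_diff exp_minus exp_sum exp_add divide_inverse add_pos_pos)
  also have "\<dots> = (\<Sum>S\<in>Pow {..<n}. \<rho> ^ card S * exp (2 * b * d * (\<Sum>i\<in>S. R i) - b * d\<^sup>2 * ?M))"
    unfolding prod_one_plus_expand[OF finite_lessThan] sum_distrib_right
  proof (intro sum.cong refl)
    fix S assume "S \<in> Pow {..<n}"
    hence "finite S" using finite_subset by blast
    thus "(\<Prod>i\<in>S. \<rho> * exp (2 * b * d * R i)) * exp (- b * d\<^sup>2 * ?M)
        = \<rho> ^ card S * exp (2 * b * d * (\<Sum>i\<in>S. R i) - b * d\<^sup>2 * ?M)"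
      by (simp add: prod.distrib sum_distrib_left exp_sum exp_diff exp_minus divide_inverse)
  qed
  also have "\<dots> \<le> toeplitz_partition b q \<rho> n"
    unfolding toeplitz_partition_def
  proof (intro sum_mono mult_left_mono)
    fix S assume "S \<in> Pow {..<n}"
    hence "b * (2 * d * (\<Sum>i\<in>S. R i) - d\<^sup>2 * ?M) \<le> b * toeplitz_energy q n S"
      using assms by (intro mult_left_mono lin) auto
    thus "exp (2 * b * d * (\<Sum>i\<in>S. R i) - b * d\<^sup>2 * ?M) \<le> exp (b * toeplitz_energy q n S)"
      by (simp add: algebra_simps)
  qed (use assms in auto)
  finally show ?thesis unfolding H_def .
qed

section \<open>The thermodynamic limit\<close>

text \<open>A variant of Fekete's lemma. The limit is the infimum of \<open>p n + C / n\<close>: no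
  value lies below it, and a nearly optimal fixed \<open>n\<close> controls \<open>p N\<close> from
  above for all large \<open>N\<close>.\<close>

lemma convergent_if_almost_decreasing:
  fixes p E :: "nat \<Rightarrow> real"
  assumes p: "\<And>n. 0 \<le> p n" and C: "0 \<le> C"
    and le: "\<And>n N. 1 \<le> n \<Longrightarrow> 1 \<le> N \<Longrightarrow> p N \<le> p n + C / n + E n / N"
  shows "convergent p"
proof -
  define L where "L = (INF n\<in>{1..}. p n + C / n)"
  have bdd: "bdd_below ((\<lambda>n. p n + C / n) ` {1..})"
    using p C by (intro bdd_belowI2[where m = 0]) auto
  have lower: "L \<le> p N + C / N" if "1 \<le> N" for N
    unfolding L_def using that by (intro cINF_lower[OF bdd]) auto
  have "p \<longlonglongrightarrow> L"
  proof (rule LIMSEQ_I)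
    fix e :: real assume e: "0 < e"
    have "\<exists>n\<in>{1..}. p n + C / n < L + e / 2"
      using e unfolding L_def by (subst cINF_less_iff[OF _ bdd, symmetric]) auto
    then obtain n where n: "1 \<le> n" "p n + C / n < L + e / 2" by auto
    have "\<forall>\<^sub>F N in sequentially. E n / real N < e / 2"
      using e by (intro order_tendstoD(2)[OF lim_const_over_n]) simp
    moreover have "\<forall>\<^sub>F N in sequentially. C / real N < e"
      using e by (intro order_tendstoD(2)[OF lim_const_over_n]) simp
    moreover have "\<forall>\<^sub>F N in sequentially. 1 \<le> (N::nat)" by (rule eventually_ge_at_top)
    ultimately have "\<forall>\<^sub>F N in sequentially. norm (p N - L) < e"
    proof eventually_elim
      case (elim N)
      thus ?case using elim(1,2) lower[OF elim(3)] le[OF n(1) elim(3)] n(2)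
        unfolding real_norm_def abs_less_iff by linarith
    qed
    thus "\<exists>n0. \<forall>n\<ge>n0. norm (p n - L) < e" by (simp add: eventually_sequentially)
  qed
  thus ?thesis by (rule convergentI)
qed

text \<open>Enlarging the system also changes the interaction. The longer range only raises the
  weights; the weaker coupling costs at most \<open>K * X * (1 / N - 1 / N')\<close>, which
  \<open>X \<le> N^2\<close> bounds by \<open>K * (N' - N)\<close>. The added configurations have
  nonnegative weight.\<close>

lemma grand_partition_mono_size:
  assumes "\<beta> > 0" "\<rho> > 0" "a > 0" "c > 0" and N: "1 \<le> N" "N \<le> N'"
  shows "grand_partition \<beta> \<rho> (exp_interaction a c N) N
    \<le> exp (\<beta> * c / (2 * a) * (real N' - N)) * grand_partition \<beta> \<rho> (exp_interaction a c N') N'"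
proof -
  define K where "K = \<beta> * c / (2 * a)"
  have K: "K \<ge> 0" using assms by (simp add: K_def)
  let ?E = "\<lambda>n. configuration_energy (exp_interaction a c n)"
  have energy: "- \<beta> * ?E N S \<le> K * (real N' - N) + - \<beta> * ?E N' S" if S: "S \<subseteq> {..<N}" for S
  proof -
    have S': "S \<subseteq> {..<N'}" using S N by auto
    define X where "X = toeplitz_energy (exp (- a / N)) N S - card S"
    define X' where "X' = toeplitz_energy (exp (- a / N')) N' S - card S"
    have "exp (- a / N) \<le> exp (- a / N')"
      using N assms by (simp add: frac_le)
    hence "X \<le> X'"
      unfolding X_def X'_def toeplitz_energy_eq_pairs[OF S] toeplitz_energy_eq_pairs[OF S']
      by (auto intro!: sum_mono power_mono)
    have "X \<le> real N ^ 2"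
      using toeplitz_energy_le[of "exp (- a / N)" N S] assms by (simp add: X_def)
    have "K * X / N - K * X / N' = K * X * (real N' - N) / (real N * N')"
      using N by (simp add: field_simps)
    also have "\<dots> \<le> K * real N ^ 2 * (real N' - N) / (real N * N')"
      using N K \<open>X \<le> real N ^ 2\<close> by (intro divide_right_mono mult_right_mono mult_left_mono) auto
    also have "\<dots> = K * (real N' - N) * (N / N')"
      using N by (simp add: power2_eq_square)
    also have "\<dots> \<le> K * (real N' - N) * 1"
      using N K by (intro mult_left_mono) auto
    finally have "K * X / N - K * X / N' \<le> K * (real N' - N)" by simp
    moreover have "K * X / N' \<le> K * X' / N'"
      using K \<open>X \<le> X'\<close> by (intro divide_right_mono mult_left_mono) auto
    ultimately have "K * X / N \<le> K * (real N' - N) + K * X' / N'" by simp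
    thus ?thesis
      unfolding configuration_energy_exp_interaction[OF S] configuration_energy_exp_interaction[OF S']
        X_def[symmetric] X'_def[symmetric]
      by (simp add: K_def mult_ac)
  qed
  have "grand_partition \<beta> \<rho> (exp_interaction a c N) N
      \<le> (\<Sum>S\<in>Pow {0..<N}. exp (K * (real N' - N)) * (\<rho> ^ card S * exp (- \<beta> * ?E N' S)))"
    unfolding grand_partition_def
  proof (intro sum_mono)
    fix S assume "S \<in> Pow {0..<N}"
    hence "S \<subseteq> {..<N}" by auto
    hence "exp (- \<beta> * ?E N S) \<le> exp (K * (real N' - N)) * exp (- \<beta> * ?E N' S)"
      using energy[of S] by (simp flip: exp_add)
    hence "\<rho> ^ card S * exp (- \<beta> * ?E N S)
        \<le> \<rho> ^ card S * (exp (K * (real N' - N)) * exp (- \<beta> * ?E N' S))"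
      using assms by (intro mult_left_mono) auto
    thus "\<rho> ^ card S * exp (- \<beta> * ?E N S)
        \<le> exp (K * (real N' - N)) * (\<rho> ^ card S * exp (- \<beta> * ?E N' S))"
      by (simp add: mult_ac)
  qed
  also have "\<dots> \<le> (\<Sum>S\<in>Pow {0..<N'}. exp (K * (real N' - N)) * (\<rho> ^ card S * exp (- \<beta> * ?E N' S)))"
    using N assms by (intro sum_mono2) auto
  finally show ?thesis by (simp add: grand_partition_def sum_distrib_left K_def)
qed

text \<open>Since \<open>q ^ m = exp (- a / n)\<close>, each sublattice carries the kernel of the
  system with \<open>n\<close> sites, with coupling \<open>K / n / Q\<close> in place of
  \<open>K / n\<close>. Correcting the coupling and the diagonal costs a constant independent of
  \<open>n\<close> and \<open>m\<close>.\<close>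

lemma ln_grand_partition_mult_le:
  assumes "\<beta> > 0" "\<rho> > 0" "a > 0" "c > 0" and "1 \<le> n" "1 \<le> m"
  shows "ln (grand_partition \<beta> \<rho> (exp_interaction a c (n * m)) (n * m))
    \<le> m * (ln (grand_partition \<beta> \<rho> (exp_interaction a c n) n) + \<beta> * c / (2 * a) * (a * exp a + 1))"
proof -
  let ?Z = "\<lambda>n. grand_partition \<beta> \<rho> (exp_interaction a c n) n"
  define K where "K = \<beta> * c / (2 * a)"
  define q where "q = exp (- a / real (n * m))"
  define Q where "Q = exp (- a / real n)"
  have K: "K > 0" using assms by (simp add: K_def)
  have q: "0 < q" "q \<le> 1" and Q: "0 < Q" "Q \<le> 1" and qm: "q ^ m = Q"
    using assms by (auto simp: q_def Q_def simp flip: exp_of_nat_mult)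
  have Z: "1 \<le> ?Z k" for k using assms by (intro one_le_grand_partition)
  \<comment> \<open>The excess coupling is multiplied by the maximal energy \<open>n^2\<close>. It
    stays bounded because \<open>1 - Q \<le> a / n\<close> and
    \<open>1 / Q = exp (a / n) \<le> exp a\<close>.\<close>
  have "(K / n / Q - K / n) * (real n)\<^sup>2 = K * (n * (1 / Q - 1))"
    using assms Q by (simp add: power2_eq_square field_simps)
  also have "\<dots> \<le> K * (a * exp a)"
  proof (intro mult_left_mono)
    have "1 - a / n \<le> exp (- (a / n))" using exp_ge_add_one_self[of "- (a / n)"] by simp
    hence "1 - Q \<le> a / n" by (simp add: Q_def)
    hence "n * (1 - Q) \<le> a" using assms by (simp add: field_simps)
    hence "n * (1 - Q) * (1 / Q) \<le> a * (1 / Q)" using Q by (intro mult_right_mono) auto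
    also have "1 / Q = exp (a / n)" by (simp add: Q_def exp_minus divide_inverse)
    also have "a * exp (a / n) \<le> a * exp a"
      using assms by (intro mult_left_mono) (auto simp: field_simps)
    finally show "n * (1 / Q - 1) \<le> a * exp a" using Q by (simp add: Q_def exp_minus algebra_simps divide_inverse)
  qed (use K in auto)
  finally have coupling: "(K / n / Q - K / n) * (real n)\<^sup>2 \<le> K * (a * exp a)" .
  have "?Z (n * m) \<le> toeplitz_partition (K / n / m) q \<rho> (n * m)"
    using grand_partition_le_toeplitz_partition(1)[OF assms(1-4), of "n * m"]
    by (simp add: K_def q_def mult.assoc)
  also have "\<dots> \<le> toeplitz_partition (K / n / Q) Q \<rho> n ^ m"
    using toeplitz_partition_mult_le[of \<rho> "K / n" q m n] assms K q by (simp add: qm)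
  also have "\<dots> \<le> (exp (K * (a * exp a)) * (exp K * ?Z n)) ^ m"
  proof (intro power_mono)
    have "toeplitz_partition (K / n / Q) Q \<rho> n
        \<le> exp ((K / n / Q - K / n) * (real n)\<^sup>2) * toeplitz_partition (K / n) Q \<rho> n"
      using assms K Q by (intro toeplitz_partition_change_coupling) (auto simp: field_simps)
    also have "\<dots> \<le> exp (K * (a * exp a)) * (exp K * ?Z n)"
      using coupling grand_partition_le_toeplitz_partition(2)[OF assms(1-4), of n]
      by (intro mult_mono) (auto simp: K_def Q_def toeplitz_partition_nonneg assms)
    finally show "toeplitz_partition (K / n / Q) Q \<rho> n \<le> exp (K * (a * exp a)) * (exp K * ?Z n)" .
  qed (use assms in \<open>auto intro: toeplitz_partition_nonneg\<close>)
  finally have "ln (?Z (n * m)) \<le> ln ((exp (K * (a * exp a)) * (exp K * ?Z n)) ^ m)"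
    using Z[of "n * m"] by (subst ln_le_cancel_iff) (auto simp: less_le_trans[OF zero_less_one])
  also have "\<dots> = m * (ln (?Z n) + K * (a * exp a + 1))"
    using Z[of n] by (simp add: ln_realpow ln_mult algebra_simps)
  finally show ?thesis by (simp add: K_def)
qed

lemma convergent_pressure_seq:
  assumes "\<beta> > 0" "\<rho> > 0" "a > 0" "c > 0"
  shows "convergent (pressure_seq \<beta> \<rho> a c)"
proof -
  define Z where "Z n = grand_partition \<beta> \<rho> (exp_interaction a c n) n" for n
  define K where "K = \<beta> * c / (2 * a)"
  define C where "C = K * (a * exp a + 1)"
  have K: "K > 0" and C: "C > 0" using assms by (simp_all add: K_def C_def add_pos_pos)
  have Z: "1 \<le> Z k" for k unfolding Z_def using assms by (intro one_le_grand_partition)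
  have p: "pressure_seq \<beta> \<rho> a c n = ln (Z n) / n" for n by (simp add: pressure_seq_def Z_def)
  show ?thesis
  proof (rule convergent_if_almost_decreasing)
    show "0 \<le> pressure_seq \<beta> \<rho> a c n" for n using Z[of n] by (simp add: p)
    show "0 \<le> C" using C by simp
    fix n N :: nat assume n: "1 \<le> n" and N: "1 \<le> N"
    \<comment> \<open>\<open>N\<close> is rounded up to a multiple of \<open>n\<close>, exceeding it
      by at most \<open>n\<close>, so the change of size costs at most \<open>K * n\<close> in the
      logarithm.\<close>
    define m where "m = N div n + 1"
    have "n * (N div n) + N mod n = N" by (rule mult_div_mod_eq)
    moreover have "N mod n < n" using n by simp
    moreover have "n * m = n * (N div n) + n" by (simp add: m_def)
    ultimately have m: "1 \<le> m" "N \<le> n * m" "n * m \<le> N + n" by (simp add: m_def, linarith+)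
    have "Z N \<le> exp (K * (real (n * m) - N)) * Z (n * m)"
      unfolding Z_def K_def by (intro grand_partition_mono_size assms N m)
    also have "\<dots> \<le> exp (K * n) * Z (n * m)"
    proof (intro mult_right_mono)
      have "real (n * m) - N \<le> n" using m(3) by linarith
      thus "exp (K * (real (n * m) - N)) \<le> exp (K * n)" using K by (simp add: mult_left_mono)
    qed (use Z[of "n * m"] in auto)
    finally have "ln (Z N) \<le> ln (exp (K * n) * Z (n * m))"
      using Z[of N] Z[of "n * m"] by (subst ln_le_cancel_iff) auto
    also have "\<dots> = K * n + ln (Z (n * m))" using Z[of "n * m"] by (simp add: ln_mult)
    also have "\<dots> \<le> K * n + m * (ln (Z n) + C)"
      using ln_grand_partition_mult_le[OF assms n m(1)] by (simp add: Z_def C_def K_def)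
    also have "\<dots> \<le> K * n + (N / n + 1) * (ln (Z n) + C)"
    proof (intro add_left_mono mult_right_mono)
      have "real n * m \<le> N + n" using m(3) by (metis of_nat_add of_nat_le_iff of_nat_mult)
      thus "real m \<le> N / n + 1" using n by (simp add: field_simps)
    qed (use Z[of n] C in auto)
    finally have "ln (Z N) / N \<le> (K * n + (N / n + 1) * (ln (Z n) + C)) / N"
      by (rule divide_right_mono) simp
    \<comment> \<open>The numerator \<open>K * n + ln (Z n) + C\<close> is fixed once
      \<open>n\<close> is, and serves as \<open>E n\<close> in the convergence criterion.\<close>
    also have "\<dots> = ln (Z n) / n + C / n + (K * n + ln (Z n) + C) / N"
      using n N by (simp add: field_simps)
    finally show "pressure_seq \<beta> \<rho> a c N
      \<le> pressure_seq \<beta> \<rho> a c n + C / n + (K * n + ln (Z n) + C) / N"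
      by (simp add: p)
  qed
qed

section \<open>Bounds on the limiting pressure\<close>

text \<open>The known limit may be computed along \<open>n * n\<close> sites, cut into
  \<open>n\<close> blocks of length \<open>n\<close>. Blocks are then long enough for the grid
  factor \<open>n + 1\<close> to vanish per site, yet short against the range of the
  interaction.\<close>

lemma pressure_seq_limit_le:
  assumes "\<beta> > 0" "\<rho> > 0" "a > 0" "\<alpha> > 0"
    and M: "\<And>x. 0 \<le> x \<Longrightarrow> x \<le> 1 \<Longrightarrow> vdw_functional \<rho> \<beta> \<alpha> x \<le> M"
    and L: "pressure_seq \<beta> \<rho> a (\<alpha> * a\<^sup>2) \<longlonglongrightarrow> L"
  shows "L \<le> M"
proof -
  \<comment> \<open>This is \<open>n\<close> times the block coupling
    \<open>2 * b / (q ^ n * (1 - q ^ n))\<close> for \<open>n * n\<close> sites, where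
    \<open>q ^ n = exp (- a / n)\<close>; as \<open>n * (1 - q ^ n)\<close> tends to
    \<open>a\<close>, it tends to \<open>\<alpha> * \<beta>\<close>.\<close>
  define \<gamma> where "\<gamma> n = \<beta> * \<alpha> * a / (real n * (exp (- a / real n) * (1 - exp (- a / real n))))" for n
  have "\<gamma> \<longlonglongrightarrow> \<alpha> * \<beta>"
    unfolding \<gamma>_def using assms(1,3,4) by real_asymp
  hence "(\<lambda>n. \<bar>\<gamma> n - \<alpha> * \<beta>\<bar>) \<longlonglongrightarrow> \<bar>\<alpha> * \<beta> - \<alpha> * \<beta>\<bar>" by (intro tendsto_intros)
  moreover have "(\<lambda>n. ln (real n + 1) / n) \<longlonglongrightarrow> 0" by real_asymp
  ultimately have lim: "(\<lambda>n. ln (real n + 1) / n + (M + \<bar>\<gamma> n - \<alpha> * \<beta>\<bar>)) \<longlonglongrightarrow> 0 + (M + 0)"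
    by (intro tendsto_add tendsto_const) auto
  have sub: "(\<lambda>n. pressure_seq \<beta> \<rho> a (\<alpha> * a\<^sup>2) (n * n)) \<longlonglongrightarrow> L"
  proof -
    have "filterlim (\<lambda>n::nat. n * n) at_top sequentially"
      by (rule filterlim_subseq) (auto simp: strict_mono_def intro: mult_strict_mono)
    from filterlim_compose[OF L this] show ?thesis .
  qed
  have "pressure_seq \<beta> \<rho> a (\<alpha> * a\<^sup>2) (n * n) \<le> ln (real n + 1) / n + (M + \<bar>\<gamma> n - \<alpha> * \<beta>\<bar>)"
    if n: "1 \<le> n" for n
  proof -
    define b where "b = \<beta> * (\<alpha> * a\<^sup>2) / (2 * a) / real (n * n)"
    define q where "q = exp (- a / real (n * n))"
    let ?Z = "grand_partition \<beta> \<rho> (exp_interaction a (\<alpha> * a\<^sup>2) (n * n)) (n * n)"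
    have q: "0 < q" "q < 1" using assms n by (auto simp: q_def)
    have b: "0 \<le> b" using assms by (simp add: b_def)
    have qn: "q ^ n = exp (- a / n)" using n by (simp add: q_def flip: exp_of_nat_mult)
    have \<gamma>: "\<gamma> n > 0" using assms n by (simp add: \<gamma>_def)
    have b\<gamma>: "2 * b / (q ^ n * (1 - q ^ n)) = \<gamma> n / n"
      unfolding qn using assms n by (simp add: b_def \<gamma>_def power2_eq_square mult_ac)
    \<comment> \<open>The inverse temperature is absorbed into \<open>\<gamma> n\<close>. Replacing
      \<open>\<gamma> n\<close> by \<open>\<alpha> * \<beta>\<close> changes the functional by at
      most their distance, as \<open>y^2 \<le> 1\<close>.\<close>
    have mf: "mean_field \<rho> 1 (\<gamma> n) x \<le> M + \<bar>\<gamma> n - \<alpha> * \<beta>\<bar>" for x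
    proof -
      obtain y where y: "0 \<le> y" "y \<le> 1" "mean_field \<rho> 1 (\<gamma> n) x \<le> vdw_functional \<rho> 1 (\<gamma> n) y"
        using mean_field_le_vdw_functional[OF assms(2) zero_less_one \<gamma>] .
      note y(3)
      also have "vdw_functional \<rho> 1 (\<gamma> n) y = vdw_functional \<rho> \<beta> \<alpha> y + (\<gamma> n - \<alpha> * \<beta>) * y\<^sup>2"
        by (simp add: vdw_functional_def algebra_simps)
      also have "(\<gamma> n - \<alpha> * \<beta>) * y\<^sup>2 \<le> \<bar>\<gamma> n - \<alpha> * \<beta>\<bar> * 1"
        using y by (intro mult_mono) (auto simp: power_le_one)
      finally show ?thesis using M[OF y(1,2)] by simp
    qed
    have Z: "1 \<le> ?Z" using assms by (intro one_le_grand_partition)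
    have "?Z \<le> toeplitz_partition b q \<rho> (n * n)"
      using grand_partition_le_toeplitz_partition(1)[of \<beta> \<rho> a "\<alpha> * a\<^sup>2" "n * n"] assms
      by (simp add: b_def q_def)
    also have "\<dots> \<le> (\<Sum>U\<in>Pow {..<n}. \<rho> ^ card U * exp (\<gamma> n / n * (card U)\<^sup>2)) ^ n"
      using toeplitz_partition_blocks_le[of \<rho> b q n n] assms(2) b q n by (simp only: b\<gamma>)
    also have "\<dots> \<le> ((real n + 1) * exp (n * (M + \<bar>\<gamma> n - \<alpha> * \<beta>\<bar>))) ^ n"
      using assms(2) n mf by (intro power_mono curie_weiss_partition_le sum_nonneg) auto
    finally have "ln ?Z \<le> ln (((real n + 1) * exp (n * (M + \<bar>\<gamma> n - \<alpha> * \<beta>\<bar>))) ^ n)"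
      using Z by (subst ln_le_cancel_iff) auto
    also have "\<dots> = n * (ln (real n + 1) + n * (M + \<bar>\<gamma> n - \<alpha> * \<beta>\<bar>))"
      by (simp add: ln_realpow ln_mult)
    finally have "ln ?Z / (n * n) \<le> n * (ln (real n + 1) + n * (M + \<bar>\<gamma> n - \<alpha> * \<beta>\<bar>)) / (n * n)"
      by (rule divide_right_mono) simp
    also have "\<dots> = ln (real n + 1) / n + (M + \<bar>\<gamma> n - \<alpha> * \<beta>\<bar>)"
      using n by (simp add: add_divide_distrib)
    finally show ?thesis by (simp add: pressure_seq_def)
  qed
  hence "\<forall>\<^sub>F n in sequentially. pressure_seq \<beta> \<rho> a (\<alpha> * a\<^sup>2) (n * n)
      \<le> ln (real n + 1) / n + (M + \<bar>\<gamma> n - \<alpha> * \<beta>\<bar>)"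
    by (intro eventually_sequentiallyI[of 1])
  with tendsto_le[OF _ lim sub] show ?thesis by simp
qed

text \<open>The trial density \<open>d\<close> gives the entropy \<open>h\<close> plus the energy of
  a uniform profile, which in the limit contains \<open>kernel_mean a\<close> instead of its
  asymptotic value; the subtracted term is this deficit.\<close>

lemma pressure_seq_limit_ge:
  assumes "\<beta> > 0" "\<rho> > 0" "a > 0" "\<alpha> > 0" "0 \<le> d" "d \<le> 1"
    and L: "pressure_seq \<beta> \<rho> a (\<alpha> * a\<^sup>2) \<longlonglongrightarrow> L"
  shows "vdw_functional \<rho> \<beta> \<alpha> d - \<beta> * d\<^sup>2 * (\<alpha> - \<alpha> * a\<^sup>2 * kernel_mean a) \<le> L"
proof -
  define h where "h = d * ln \<rho> - d * ln d - (1 - d) * ln (1 - d)"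
  define K where "K = \<beta> * (\<alpha> * a\<^sup>2) / (2 * a)"
  have K': "K = \<beta> * \<alpha> * a / 2" using assms by (simp add: K_def power2_eq_square)
  define M where "M n = (real n * (1 - (exp (- a / real n))\<^sup>2) - 2 * exp (- a / real n) * (1 - exp (- a)))
     / (1 - exp (- a / real n))\<^sup>2" for n
  \<comment> \<open>The limit equals \<open>2 * a * kernel_mean a\<close>. Multiplied by
    \<open>K = \<beta> * \<alpha> * a / 2\<close> it becomes
    \<open>\<beta> * \<alpha> * a^2 * kernel_mean a\<close>.\<close>
  have "(\<lambda>n. M n / (real n)\<^sup>2) \<longlonglongrightarrow> (a * 2 - (2 - 2 * exp (- a))) * inverse (a\<^sup>2)"
    unfolding M_def using assms(3) by real_asymp
  hence "(\<lambda>n. h + K * d\<^sup>2 * (M n / (real n)\<^sup>2) - K / n)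
      \<longlonglongrightarrow> h + K * d\<^sup>2 * ((a * 2 - (2 - 2 * exp (- a))) * inverse (a\<^sup>2)) - 0"
    by (intro tendsto_diff tendsto_add tendsto_mult tendsto_const lim_const_over_n)
  also have "h + K * d\<^sup>2 * ((a * 2 - (2 - 2 * exp (- a))) * inverse (a\<^sup>2)) - 0
      = vdw_functional \<rho> \<beta> \<alpha> d - \<beta> * d\<^sup>2 * (\<alpha> - \<alpha> * a\<^sup>2 * kernel_mean a)"
    using assms(3) by (simp add: h_def K' vdw_functional_def kernel_mean_def power2_eq_square
        power3_eq_cube field_simps)
  finally have lim: "(\<lambda>n. h + K * d\<^sup>2 * (M n / (real n)\<^sup>2) - K / n)
      \<longlonglongrightarrow> vdw_functional \<rho> \<beta> \<alpha> d - \<beta> * d\<^sup>2 * (\<alpha> - \<alpha> * a\<^sup>2 * kernel_mean a)" .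
  have "h + K * d\<^sup>2 * (M n / (real n)\<^sup>2) - K / n \<le> pressure_seq \<beta> \<rho> a (\<alpha> * a\<^sup>2) n"
    if n: "1 \<le> n" for n
  proof -
    define q where "q = exp (- a / real n)"
    let ?Z = "grand_partition \<beta> \<rho> (exp_interaction a (\<alpha> * a\<^sup>2) n) n"
    have q: "0 \<le> q" "q < 1" using assms n by (auto simp: q_def)
    have "q ^ n = exp (- a)" using n by (simp add: q_def flip: exp_of_nat_mult)
    hence M: "toeplitz_form q n (\<lambda>_. 1) (\<lambda>_. 1) = M n"
      using q n by (subst toeplitz_form_one) (auto simp: M_def q_def)
    have Z: "1 \<le> ?Z" using assms by (intro one_le_grand_partition)
    have "exp (n * h + K / n * d\<^sup>2 * M n) \<le> toeplitz_partition (K / n) q \<rho> n"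
      unfolding h_def M[symmetric] using assms q by (intro toeplitz_partition_ge) (auto simp: K_def)
    also have "\<dots> \<le> exp K * ?Z"
      using grand_partition_le_toeplitz_partition(2)[of \<beta> \<rho> a "\<alpha> * a\<^sup>2" n] assms
      by (simp add: K_def q_def)
    finally have "ln (exp (n * h + K / n * d\<^sup>2 * M n)) \<le> ln (exp K * ?Z)"
      using Z by (subst ln_le_cancel_iff) auto
    hence "n * h + K / n * d\<^sup>2 * M n - K \<le> ln ?Z" using Z by (simp add: ln_mult)
    hence "(n * h + K / n * d\<^sup>2 * M n - K) / n \<le> ln ?Z / n" by (rule divide_right_mono) simp
    also have "(n * h + K / n * d\<^sup>2 * M n - K) / n = h + K * d\<^sup>2 * (M n / (real n)\<^sup>2) - K / n"
      using n by (simp add: add_divide_distrib diff_divide_distrib power2_eq_square)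
    finally show ?thesis by (simp add: pressure_seq_def)
  qed
  hence "\<forall>\<^sub>F n in sequentially. h + K * d\<^sup>2 * (M n / (real n)\<^sup>2) - K / n
      \<le> pressure_seq \<beta> \<rho> a (\<alpha> * a\<^sup>2) n"
    by (intro eventually_sequentiallyI[of 1])
  with tendsto_le[OF _ L lim] show ?thesis by simp
qed

section \<open>The constants of the kernel\<close>

text \<open>Before the first pole of the tangent, at \<open>pi / a\<close>, the function
  \<open>y * tan (a * y / 2)\<close> increases strictly from 0 to infinity. Its unique root there is
  below every other positive root, so \<open>LEAST\<close> does denote it.\<close>

lemma smallest_root_bounds:
  assumes "a > 0"
  shows "0 < smallest_root a" "smallest_root a \<le> pi / a"
proof -
  let ?f = "\<lambda>y. y * tan (1 / 2 * a * y)"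
  have cos: "cos (1 / 2 * a * y) > 0" if "0 \<le> y" "y < pi / a" for y
    using that assms by (intro cos_gt_zero_pi) (auto simp: field_simps intro: less_le_trans[of _ 0])
  have mono: "?f x < ?f y" if "0 < x" "x < y" "y < pi / a" for x y
  proof -
    have "0 < a * x" "a * x < a * y" "a * y < pi" using that assms by (auto simp: field_simps)
    hence "0 < tan (1 / 2 * a * x)" "tan (1 / 2 * a * x) < tan (1 / 2 * a * y)"
      by (auto intro!: tan_gt_zero tan_monotone)
    thus ?thesis using that by (intro mult_strict_mono) auto
  qed
  obtain y where y: "0 < y" "y < pi / a" "?f y = 1"
  proof -
    have "filterlim (\<lambda>y. tan (1 / 2 * a * y)) at_top (at_left (pi / a))"
    proof (rule filterlim_compose[OF filterlim_tan_at_left])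
      show "filterlim (\<lambda>y. 1 / 2 * a * y) (at_left (pi / 2)) (at_left (pi / a))"
        unfolding filterlim_at
      proof
        have "((\<lambda>y. 1 / 2 * a * y) \<longlongrightarrow> 1 / 2 * a * (pi / a)) (at_left (pi / a))"
          by (intro tendsto_intros)
        thus "((\<lambda>y. 1 / 2 * a * y) \<longlongrightarrow> pi / 2) (at_left (pi / a))" using assms by simp
        show "\<forall>\<^sub>F y in at_left (pi / a). 1 / 2 * a * y \<in> {..<pi / 2} \<and> 1 / 2 * a * y \<noteq> pi / 2"
          unfolding eventually_at_filter using assms by (intro always_eventually) (auto simp: field_simps)
      qed
    qed
    \<comment> \<open>The threshold is the reciprocal of the midpoint \<open>pi / (2 * a)\<close>:
      at a point of the right half with such a tangent the product is at least 1.\<close>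
    hence "\<forall>\<^sub>F y in at_left (pi / a). 2 * a / pi \<le> tan (1 / 2 * a * y)"
      by (simp add: filterlim_at_top)
    moreover have "\<forall>\<^sub>F y in at_left (pi / a). y \<in> {pi / (2 * a)<..<pi / a}"
      using assms by (intro eventually_at_left_real) (simp add: divide_strict_left_mono)
    ultimately have "\<forall>\<^sub>F y in at_left (pi / a). y \<in> {pi / (2 * a)<..<pi / a} \<and> 2 * a / pi \<le> tan (1 / 2 * a * y)"
      by eventually_elim auto
    then obtain z where z: "pi / (2 * a) < z" "z < pi / a" "2 * a / pi \<le> tan (1 / 2 * a * z)"
      using eventually_happens[of _ "at_left (pi / a)"] by auto
    have z0: "0 < z" using z(1) assms by (smt (verit) divide_pos_pos pi_gt_zero)
    have "1 = pi / (2 * a) * (2 * a / pi)" using assms by simp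
    also have "\<dots> \<le> ?f z" using z z0 assms by (intro mult_mono) auto
    finally have "1 \<le> ?f z" .
    moreover have "continuous_on {0..z} ?f"
      using cos z by (intro continuous_intros) (auto intro!: less_imp_neq[symmetric])
    ultimately obtain y where "0 \<le> y" "y \<le> z" "?f y = 1"
      using IVT'[of ?f 0 1 z] z0 by auto
    moreover from this have "y \<noteq> 0" by auto
    ultimately show thesis using z that[of y] by auto
  qed
  have "smallest_root a = y"
    unfolding smallest_root_def
  proof (rule Least_equality)
    show "y > 0 \<and> ?f y = 1" using y by simp
    fix x assume "x > 0 \<and> ?f x = 1"
    thus "y \<le> x" using mono[of x y] y by force
  qed
  thus "0 < smallest_root a" "smallest_root a \<le> pi / a" using y by auto
qed

text \<open>The factor \<open>a^2\<close> cancels, leaving \<open>\<alpha> / (1 + y^2)\<close> with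
  \<open>y\<close> the smallest root, squeezed to 0 by \<open>pi / a\<close>.\<close>

lemma top_eigenvalue_scaled_tendsto: "((\<lambda>a. \<alpha> * a\<^sup>2 * top_eigenvalue a) \<longlongrightarrow> \<alpha>) at_top"
proof -
  have "(smallest_root \<longlongrightarrow> 0) at_top"
  proof (rule tendsto_sandwich)
    show "\<forall>\<^sub>F a in at_top. 0 \<le> smallest_root a"
      using eventually_gt_at_top[of 0] by eventually_elim (intro less_imp_le smallest_root_bounds(1))
    show "\<forall>\<^sub>F a in at_top. smallest_root a \<le> pi / a"
      using eventually_gt_at_top[of 0] by eventually_elim (rule smallest_root_bounds(2))
    show "((\<lambda>a::real. pi / a) \<longlongrightarrow> 0) at_top" by real_asymp
    show "((\<lambda>a::real. 0::real) \<longlongrightarrow> 0) at_top" by simp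
  qed
  hence "((\<lambda>a. \<alpha> / (1 + (smallest_root a)\<^sup>2)) \<longlongrightarrow> \<alpha> / (1 + 0\<^sup>2)) at_top"
    by (intro tendsto_intros) auto
  hence "((\<lambda>a. \<alpha> / (1 + (smallest_root a)\<^sup>2)) \<longlongrightarrow> \<alpha>) at_top" by simp
  moreover have "\<forall>\<^sub>F a in at_top. \<alpha> / (1 + (smallest_root a)\<^sup>2) = \<alpha> * a\<^sup>2 * top_eigenvalue a"
    using eventually_gt_at_top[of 0] by eventually_elim (simp add: top_eigenvalue_def)
  ultimately show ?thesis by (rule Lim_transform_eventually)
qed

lemma kernel_mean_scaled_tendsto: "((\<lambda>a. \<alpha> * a\<^sup>2 * kernel_mean a) \<longlongrightarrow> \<alpha>) at_top"
proof -
  have "((\<lambda>a::real. a\<^sup>2 * (1 / a ^ 3 * (a + exp (- a) - 1))) \<longlongrightarrow> 1) at_top" by real_asymp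
  hence "((\<lambda>a. \<alpha> * (a\<^sup>2 * kernel_mean a)) \<longlongrightarrow> \<alpha> * 1) at_top"
    unfolding kernel_mean_def by (intro tendsto_mult tendsto_const)
  thus ?thesis by (simp add: mult.assoc)
qed

section \<open>Conclusion: squeezing the pressure\<close>

theorem mainTheorem3:
  fixes \<rho> \<beta> \<alpha> T :: real and c :: "real \<Rightarrow> real"
  assumes "\<rho> > 0" and "\<beta> > 0" and "\<alpha> > 0"
    and "T = 1 / \<beta>"
    and "\<And>a. c a = \<alpha> * a\<^sup>2"
  shows "(\<forall>a>0. \<forall>c'>0. convergent (pressure_seq \<beta> \<rho> a c')) \<and>
    ((\<lambda>a. c a * top_eigenvalue a) \<longlongrightarrow> \<alpha>) at_top \<and>
    ((\<lambda>a. c a * kernel_mean a) \<longlongrightarrow> \<alpha>) at_top \<and>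
    (\<exists>d. is_arg_max (vdw_functional \<rho> \<beta> \<alpha>) (\<lambda>x. x \<in> {0..1}) d) \<and>
    (\<forall>d. is_arg_max (vdw_functional \<rho> \<beta> \<alpha>) (\<lambda>x. x \<in> {0..1}) d \<longrightarrow>
       0 < d \<and> d < 1 \<and>
       ((\<lambda>a. pressure \<beta> \<rho> a (c a)) \<longlongrightarrow> - T * ln (1 - d) - \<alpha> * d\<^sup>2) at_top \<and>
       \<rho> = exp (- 2 * \<alpha> * \<beta> * d) * (d / (1 - d)))"
proof (intro conjI allI impI)
  fix a c' :: real assume "a > 0" "c' > 0"
  thus "convergent (pressure_seq \<beta> \<rho> a c')" using assms by (intro convergent_pressure_seq)
next
  show "((\<lambda>a. c a * top_eigenvalue a) \<longlongrightarrow> \<alpha>) at_top"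
    unfolding assms(5) by (rule top_eigenvalue_scaled_tendsto)
  show "((\<lambda>a. c a * kernel_mean a) \<longlongrightarrow> \<alpha>) at_top"
    unfolding assms(5) by (rule kernel_mean_scaled_tendsto)
  show "\<exists>d. is_arg_max (vdw_functional \<rho> \<beta> \<alpha>) (\<lambda>x. x \<in> {0..1}) d"
    by (intro vdw_functional_has_maximizer assms)
next
  fix d assume max: "is_arg_max (vdw_functional \<rho> \<beta> \<alpha>) (\<lambda>x. x \<in> {0..1}) d"
  note d = vdw_functional_maximizer[OF assms(1-3) max]
  show "0 < d" "d < 1" "\<rho> = exp (- 2 * \<alpha> * \<beta> * d) * (d / (1 - d))" by (fact d)+
  let ?F = "vdw_functional \<rho> \<beta> \<alpha>"
  have F_le: "?F x \<le> ?F d" if "0 \<le> x" "x \<le> 1" for x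
    using max that unfolding is_arg_max_linorder by auto
  \<comment> \<open>The logarithm of the density equation eliminates \<open>\<rho>\<close> from the
    maximum, which reduces to the van der Waals expression.\<close>
  have ln_\<rho>: "ln \<rho> = - 2 * \<alpha> * \<beta> * d + ln d - ln (1 - d)"
    using d(1,2) by (subst d(3)) (simp add: ln_mult ln_div)
  have F_d: "?F d = - ln (1 - d) - \<alpha> * \<beta> * d\<^sup>2"
    unfolding vdw_functional_def ln_\<rho> by (simp add: power2_eq_square algebra_simps)
  have bounds: "?F d - \<beta> * d\<^sup>2 * (\<alpha> - \<alpha> * a\<^sup>2 * kernel_mean a) \<le> \<beta> * pressure \<beta> \<rho> a (c a)
      \<and> \<beta> * pressure \<beta> \<rho> a (c a) \<le> ?F d" if a: "a > 0" for a
  proof -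
    \<comment> \<open>\<open>pressure\<close> is defined through \<open>lim\<close>, which is the
      actual limit only once convergence is established.\<close>
    have "convergent (pressure_seq \<beta> \<rho> a (\<alpha> * a\<^sup>2))"
      using a assms by (intro convergent_pressure_seq) auto
    hence L: "pressure_seq \<beta> \<rho> a (\<alpha> * a\<^sup>2) \<longlonglongrightarrow> \<beta> * pressure \<beta> \<rho> a (c a)"
      using assms by (simp add: pressure_def convergent_LIMSEQ_iff)
    show ?thesis
      using pressure_seq_limit_ge[OF assms(2,1) a assms(3) _ _ L, of d]
        pressure_seq_limit_le[OF assms(2,1) a assms(3) F_le L] d(1,2) by simp
  qed
  have "((\<lambda>a. \<beta> * pressure \<beta> \<rho> a (c a)) \<longlongrightarrow> ?F d) at_top"
  proof (rule tendsto_sandwich)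
    have "((\<lambda>a. ?F d - \<beta> * d\<^sup>2 * (\<alpha> - \<alpha> * a\<^sup>2 * kernel_mean a))
        \<longlongrightarrow> ?F d - \<beta> * d\<^sup>2 * (\<alpha> - \<alpha>)) at_top"
      by (intro tendsto_diff tendsto_mult[of "\<lambda>_. \<beta> * d\<^sup>2"] tendsto_const kernel_mean_scaled_tendsto)
    thus "((\<lambda>a. ?F d - \<beta> * d\<^sup>2 * (\<alpha> - \<alpha> * a\<^sup>2 * kernel_mean a)) \<longlongrightarrow> ?F d) at_top"
      by simp
    show "\<forall>\<^sub>F a in at_top. ?F d - \<beta> * d\<^sup>2 * (\<alpha> - \<alpha> * a\<^sup>2 * kernel_mean a) \<le> \<beta> * pressure \<beta> \<rho> a (c a)"
      using eventually_gt_at_top[of 0] by eventually_elim (use bounds in blast)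
    show "\<forall>\<^sub>F a in at_top. \<beta> * pressure \<beta> \<rho> a (c a) \<le> ?F d"
      using eventually_gt_at_top[of 0] by eventually_elim (use bounds in blast)
  qed (rule tendsto_const)
  hence "((\<lambda>a. T * (\<beta> * pressure \<beta> \<rho> a (c a))) \<longlongrightarrow> T * ?F d) at_top"
    by (intro tendsto_intros)
  moreover have "T * ?F d = - T * ln (1 - d) - \<alpha> * d\<^sup>2"
    unfolding F_d assms(4) using assms(2) by (simp add: field_simps)
  ultimately show "((\<lambda>a. pressure \<beta> \<rho> a (c a)) \<longlongrightarrow> - T * ln (1 - d) - \<alpha> * d\<^sup>2) at_top"
    using assms(2) by (simp add: assms(4))
qed

end
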